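(* Suppose the Main Assumption (see context) is satisfied, with equivalence relation $\mathcal R$ on $(X,\mu)$, bundle of hyperbolic spaces $\pi:\mathcal H\to X$ and isometric action $\alpha$. Let $\sigma,\eta:X\to\mathcal H$ be metrically proper Borel sections whose orbit closures $\overline{\mathcal O^\sigma_x}$, $\overline{\mathcal O^\eta_x}$ in $\overline{\mathcal H}_x$ are compact for a.e. $x$. Then $\mathcal L^\sigma_x=\mathcal L^\eta_x$ for a.e. $x\in X$.
   Context: Equivalence relations. $(X,\mu)$ is a standard probability space. A Borel equivalence relation $\mathcal R\subset X\times X$ is discrete if every class $[x]_{\mathcal R}$ is countable; $x\mathcal R y$ means $(x,y)\in\mathcal R$. $\mu$ is $\mathcal R$-invariant if $\phi_*\mu=\mu$ for every Borel isomorphism $\phi:X\to X$ with graph contained in $\mathcal R$. $\mu$ is ergodic if every Borel set $Y\subset X$ that is a union of $\mathcal R$-classes has $\mu(Y)\in\{0,1\}$. Hyperbolic spaces. In a metric space $(H,d)$ put $(x|y)_z=\frac12(d(x,z)+d(y,z)-d(x,y))$. $H$ is $\delta$-hyperbolic if $(x|y)_z\ge\min\{(x|w)_z,(w|y)_z\}-\delta$ for all $x,y,z,w$; Gromov hyperbolic means $\delta$-hyperbolic for some $\delta$. $\partial H$ is the Gromov boundary: equivalence classes of sequences with $(x_i|x_j)_z\to\infty$ as $i,j\to\infty$, two such sequences being equivalent if $(x_i|y_j)_z\to\infty$. $\overline H=H\cup\partial H$ is the Gromov completion with its usual topology. Bundles and actions. A Borel bundle over $X$ is a standard Borel space $B$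 with a Borel surjection $\pi:B\to X$; the fibers are $B_x=\pi^{-1}(x)$, and $B*B=\{(y,z):\pi(y)=\pi(z)\}$. A metric bundle also has a Borel map $d:B*B\to[0,\infty)$ restricting to a metric on each $B_x$. A section is a map $\sigma:X\to B$ with $\sigma(x)\in B_x$. The bundle is separable if there are countably many Borel sections $\sigma_i$ with $\{\sigma_i(x)\}_i$ dense in $B_x$ for every $x$. A bundle of hyperbolic spaces is a metric bundle $\pi:\mathcal H\to X$ whose fibers are geodesic Gromov hyperbolic spaces. An isometric action of $\mathcal R$ on $\mathcal H$ is a family of isometries $\alpha(x,y):\mathcal H_y\to\mathcal H_x$, $(x,y)\in\mathcal R$, with $\alpha(x,y)\alpha(y,z)=\alpha(x,z)$ whenever $x\mathcal R y\mathcal R z$ and with $\{(p,q)\in\mathcal H\times\mathcal H:\alpha(\pi(p),\pi(q))(q)=p\}$ Borel. Orbits and limit sets. For a section $\sigma$ of $\mathcal H$, let $\sigma_x(y)=\alpha(x,y)\sigma(y)$ for $y\in[x]_{\mathcal R}$, and let the orbit $\mathcal O^\sigma_x\subset\mathcal H_x$ be the image $\sigma_x([x]_{\mathcal R})$. $\sigma$ is metrically proper if for every metric ball $\mathcal B\subset\mathcal H_x$ the set $\mathcal O^\sigma_x\cap\mathcal B$ is finite ($\sigma_x$ is not required to be injective). The limit set is $\mathcal L^\sigma_x=\overline{\mathcal O^\sigma_x}\cap\partial\mathcal H_x$, closure taken in $\overline{\mathcal H}_x$. Main Assumption: $(X,\mu)$ is a standard non-atomic probability space, $\mathcal R\subset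 X\times X$ is a discrete Borel equivalence relation, $\mu$ is $\mathcal R$-invariant and ergodic, $\pi:\mathcal H\to X$ is a separable bundle of hyperbolic spaces with an isometric action $\alpha$ of $\mathcal R$, and $\sigma:X\to\mathcal H$ is a metrically proper Borel section such that $\overline{\mathcal O^\sigma_x}$ is compact in $\overline{\mathcal H}_x$ for a.e. $x$.
   Formalization: Metrically proper is taken with multiplicity: for each ball B in H_x only finitely many y in [x] have σ_x(y) in B; with only the set O^σ_x∩B finite the claim fails (trivial action on X×[0,∞), σ(x)=(x,0), η(x)=(x,f(x)), f taking each natural number with positive measure). *)

theory Defs
  imports "HOL-Probability.Probability"
begin

section \<open>Standard Borel spaces and measured equivalence relations\<close>

text \<open>A measurable space is standard Borel if its \<open>\<sigma>\<close>-algebra is the Borel algebra of some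
  Polish topology.\<close>

definition standard_borel :: "'a measure \<Rightarrow> bool" where
  "standard_borel M \<longleftrightarrow>
     (\<exists>T. completely_metrizable_space T \<and> second_countable T \<and> topspace T = space M \<and>
          sets M = sigma_sets (topspace T) {U. openin T U})"

definition non_atomic :: "'a measure \<Rightarrow> bool" where
  "non_atomic M \<longleftrightarrow>
     (\<forall>A\<in>sets M. 0 < emeasure M A \<longrightarrow>
        (\<exists>A'\<in>sets M. A' \<subseteq> A \<and> 0 < emeasure M A' \<and> emeasure M A' < emeasure M A))"

definition discrete_borel_equiv :: "'a measure \<Rightarrow> ('a \<times> 'a) set \<Rightarrow> bool" where
  "discrete_borel_equiv M R \<longleftrightarrow>
     R \<in> sets (M \<Otimes>\<^sub>M M) \<and> equiv (space M) R \<and> (\<forall>x\<in>space M. countable (R `` {x}))"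

definition borel_automorphism :: "'a measure \<Rightarrow> ('a \<Rightarrow> 'a) \<Rightarrow> bool" where
  "borel_automorphism M \<phi> \<longleftrightarrow>
     \<phi> \<in> measurable M M \<and> bij_betw \<phi> (space M) (space M) \<and>
     the_inv_into (space M) \<phi> \<in> measurable M M"

definition invariant_under :: "'a measure \<Rightarrow> ('a \<times> 'a) set \<Rightarrow> bool" where
  "invariant_under M R \<longleftrightarrow>
     (\<forall>\<phi>. borel_automorphism M \<phi> \<and> (\<forall>x\<in>space M. (x, \<phi> x) \<in> R) \<longrightarrow> distr M M \<phi> = M)"

definition ergodic_under :: "'a measure \<Rightarrow> ('a \<times> 'a) set \<Rightarrow> bool" where
  "ergodic_under M R \<longleftrightarrow>
     (\<forall>Y\<in>sets M. Y = (\<Union>y\<in>Y. R `` {y}) \<longrightarrow> emeasure M Y = 0 \<or> emeasure M Y = 1)"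


section \<open>Gromov hyperbolic spaces\<close>

definition gromov_product :: "'b metric \<Rightarrow> 'b \<Rightarrow> 'b \<Rightarrow> 'b \<Rightarrow> real" where
  "gromov_product m z x y = (mdist m x z + mdist m y z - mdist m x y) / 2"

definition delta_hyperbolic :: "real \<Rightarrow> 'b metric \<Rightarrow> bool" where
  "delta_hyperbolic \<delta> m \<longleftrightarrow>
     (\<forall>x\<in>mspace m. \<forall>y\<in>mspace m. \<forall>z\<in>mspace m. \<forall>w\<in>mspace m.
        gromov_product m z x y \<ge> min (gromov_product m z x w) (gromov_product m z w y) - \<delta>)"

definition gromov_hyperbolic :: "'b metric \<Rightarrow> bool" where
  "gromov_hyperbolic m \<longleftrightarrow> (\<exists>\<delta>. delta_hyperbolic \<delta> m)"

definition geodesic_metric :: "'b metric \<Rightarrow> bool" where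
  "geodesic_metric m \<longleftrightarrow>
     (\<forall>p\<in>mspace m. \<forall>q\<in>mspace m. \<exists>\<gamma>::real \<Rightarrow> 'b.
        \<gamma> ` {0..mdist m p q} \<subseteq> mspace m \<and> \<gamma> 0 = p \<and> \<gamma> (mdist m p q) = q \<and>
        (\<forall>s\<in>{0..mdist m p q}. \<forall>t\<in>{0..mdist m p q}. mdist m (\<gamma> s) (\<gamma> t) = \<bar>s - t\<bar>))"

text \<open>\<open>(x\<^sub>i|y\<^sub>j)\<^sub>z \<rightarrow> \<infinity>\<close> jointly in \<open>i, j\<close>. Changing \<open>z\<close> changes the products by a bounded amount,
  so it makes no difference whether one or every base point is asked for.\<close>

definition product_diverges :: "'b metric \<Rightarrow> (nat \<Rightarrow> 'b) \<Rightarrow> (nat \<Rightarrow> 'b) \<Rightarrow> bool" where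
  "product_diverges m x y \<longleftrightarrow>
     (\<forall>z\<in>mspace m. filterlim (\<lambda>(i, j). gromov_product m z (x i) (y j)) at_top
                      (sequentially \<times>\<^sub>F sequentially))"

definition gromov_sequences :: "'b metric \<Rightarrow> (nat \<Rightarrow> 'b) set" where
  "gromov_sequences m = {x. range x \<subseteq> mspace m \<and> product_diverges m x x}"

definition gromov_boundary :: "'b metric \<Rightarrow> (nat \<Rightarrow> 'b) set set" where
  "gromov_boundary m = gromov_sequences m //
     {(x, y). x \<in> gromov_sequences m \<and> y \<in> gromov_sequences m \<and> product_diverges m x y}"

definition gromov_completion :: "'b metric \<Rightarrow> ('b + (nat \<Rightarrow> 'b) set) set" where
  "gromov_completion m = mspace m <+> gromov_boundary m"

text \<open>The Gromov product on the completion is the infimum, over sequences representing the two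
  points, of the lower limit of the products of their terms. Taking the supremum instead (the other
  convention in use) changes it by at most a multiple of the hyperbolicity constant, and hence
  does not affect the topology below.\<close>

primrec representatives :: "'b + (nat \<Rightarrow> 'b) set \<Rightarrow> (nat \<Rightarrow> 'b) set" where
  "representatives (Inl p) = {\<lambda>_. p}"
| "representatives (Inr \<xi>) = \<xi>"

definition extended_gromov_product ::
    "'b metric \<Rightarrow> 'b \<Rightarrow> 'b + (nat \<Rightarrow> 'b) set \<Rightarrow> 'b + (nat \<Rightarrow> 'b) set \<Rightarrow> ereal" where
  "extended_gromov_product m z a b =
     (INF x\<in>representatives a. INF y\<in>representatives b.
        Liminf (sequentially \<times>\<^sub>F sequentially) (\<lambda>(i, j). ereal (gromov_product m z (x i) (y j))))"

text \<open>A set is open in the completion if its part in the space is open there and it contains, with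
  each of its boundary points \<open>\<xi>\<close>, some \<open>{a. (\<xi>|a)\<^sub>z > t}\<close>. Again the choice of \<open>z\<close> is immaterial.\<close>

definition gromov_open :: "'b metric \<Rightarrow> ('b + (nat \<Rightarrow> 'b) set) set \<Rightarrow> bool" where
  "gromov_open m U \<longleftrightarrow>
     U \<subseteq> gromov_completion m \<and> openin (mtopology_of m) (Inl -` U) \<and>
     (\<forall>\<xi>. Inr \<xi> \<in> U \<longrightarrow> (\<forall>z\<in>mspace m. \<exists>t::real.
        {a \<in> gromov_completion m. extended_gromov_product m z (Inr \<xi>) a > ereal t} \<subseteq> U))"

definition gromov_topology :: "'b metric \<Rightarrow> ('b + (nat \<Rightarrow> 'b) set) topology" where
  "gromov_topology m = topology (gromov_open m)"

lemma istopology_gromov_open: "istopology (gromov_open m)"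
  unfolding istopology_def
proof (intro conjI allI impI)
  fix U V assume U: "gromov_open m U" and V: "gromov_open m V"
  show "gromov_open m (U \<inter> V)"
    unfolding gromov_open_def
  proof (intro conjI allI impI ballI)
    show "U \<inter> V \<subseteq> gromov_completion m" using U by (auto simp: gromov_open_def)
    show "openin (mtopology_of m) (Inl -` (U \<inter> V))"
      using U V by (auto simp: gromov_open_def)
    fix \<xi> z assume "Inr \<xi> \<in> U \<inter> V" and z: "z \<in> mspace m"
    then obtain s t :: real
      where s: "{a \<in> gromov_completion m. extended_gromov_product m z (Inr \<xi>) a > ereal s} \<subseteq> U"
        and t: "{a \<in> gromov_completion m. extended_gromov_product m z (Inr \<xi>) a > ereal t} \<subseteq> V"
      using U V unfolding gromov_open_def by blast
    have "ereal s \<le> ereal (max s t)" "ereal t \<le> ereal (max s t)" by auto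
    then have "{a \<in> gromov_completion m. extended_gromov_product m z (Inr \<xi>) a > ereal (max s t)}
        \<subseteq> U \<inter> V"
      using s t by (blast intro: order.strict_trans1)
    then show "\<exists>t::real.
        {a \<in> gromov_completion m. extended_gromov_product m z (Inr \<xi>) a > ereal t} \<subseteq> U \<inter> V" ..
  qed
next
  fix \<K> :: "('a + (nat \<Rightarrow> 'a) set) set set" assume K: "\<forall>U\<in>\<K>. gromov_open m U"
  show "gromov_open m (\<Union>\<K>)"
    unfolding gromov_open_def
  proof (intro conjI allI impI ballI)
    show "\<Union>\<K> \<subseteq> gromov_completion m" using K by (auto simp: gromov_open_def)
    have "Inl -` \<Union>\<K> = (\<Union>U\<in>\<K>. Inl -` U)" by auto
    then show "openin (mtopology_of m) (Inl -` \<Union>\<K>)"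
      using K by (auto simp: gromov_open_def)
    fix \<xi> z assume "Inr \<xi> \<in> \<Union>\<K>" and z: "z \<in> mspace m"
    then obtain U where U: "U \<in> \<K>" "Inr \<xi> \<in> U" by blast
    then obtain t :: real
      where "{a \<in> gromov_completion m. extended_gromov_product m z (Inr \<xi>) a > ereal t} \<subseteq> U"
      using K z unfolding gromov_open_def by blast
    then show "\<exists>t::real.
        {a \<in> gromov_completion m. extended_gromov_product m z (Inr \<xi>) a > ereal t} \<subseteq> \<Union>\<K>"
      using U by blast
  qed
qed

lemma openin_gromov_topology: "openin (gromov_topology m) U \<longleftrightarrow> gromov_open m U"
  by (simp add: gromov_topology_def istopology_gromov_open)

lemma topspace_gromov_topology [simp]: "topspace (gromov_topology m) = gromov_completion m"
proof -
  have "Inl -` gromov_completion m = mspace m"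
    by (auto simp: gromov_completion_def)
  then have "gromov_open m (gromov_completion m)"
    by (auto simp: gromov_open_def) (metis openin_topspace topspace_mtopology_of)
  then show ?thesis
    by (auto simp: topspace_def openin_gromov_topology gromov_open_def)
qed


section \<open>Bundles and actions\<close>

text \<open>Bundles are given by the measurable space \<open>B\<close> of the total space and its projection
  \<open>\<pi>\<close> to \<open>M\<close>; the distance \<open>d\<close> matters only on pairs in a common fiber.\<close>

definition fiber :: "'b measure \<Rightarrow> ('b \<Rightarrow> 'a) \<Rightarrow> 'a \<Rightarrow> 'b set" where
  "fiber B \<pi> x = {p \<in> space B. \<pi> p = x}"

definition fiber_product :: "'b measure \<Rightarrow> ('b \<Rightarrow> 'a) \<Rightarrow> ('b \<times> 'b) set" where
  "fiber_product B \<pi> = {(p, q). p \<in> space B \<and> q \<in> space B \<and> \<pi> p = \<pi> q}"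

text \<open>The library's \<^locale>\<open>Metric_space\<close> asks for nonnegativity and symmetry also off the carrier,
  hence the extension by \<open>0\<close>.\<close>

definition dist_on :: "'b set \<Rightarrow> ('b \<Rightarrow> 'b \<Rightarrow> real) \<Rightarrow> 'b \<Rightarrow> 'b \<Rightarrow> real" where
  "dist_on S d p q = (if p \<in> S \<and> q \<in> S then d p q else 0)"

definition fiber_metric ::
    "'b measure \<Rightarrow> ('b \<Rightarrow> 'a) \<Rightarrow> ('b \<Rightarrow> 'b \<Rightarrow> real) \<Rightarrow> 'a \<Rightarrow> 'b metric" where
  "fiber_metric B \<pi> d x = metric (fiber B \<pi> x, dist_on (fiber B \<pi> x) d)"

definition borel_bundle :: "'a measure \<Rightarrow> 'b measure \<Rightarrow> ('b \<Rightarrow> 'a) \<Rightarrow> bool" where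
  "borel_bundle M B \<pi> \<longleftrightarrow>
     standard_borel B \<and> \<pi> \<in> measurable B M \<and> \<pi> ` space B = space M"

definition metric_bundle ::
    "'a measure \<Rightarrow> 'b measure \<Rightarrow> ('b \<Rightarrow> 'a) \<Rightarrow> ('b \<Rightarrow> 'b \<Rightarrow> real) \<Rightarrow> bool" where
  "metric_bundle M B \<pi> d \<longleftrightarrow>
     borel_bundle M B \<pi> \<and>
     (\<lambda>(p, q). d p q) \<in> borel_measurable (restrict_space (B \<Otimes>\<^sub>M B) (fiber_product B \<pi>)) \<and>
     (\<forall>x\<in>space M. Metric_space (fiber B \<pi> x) (dist_on (fiber B \<pi> x) d))"

lemma metric_bundle_fiber_metric:
  assumes "metric_bundle M B \<pi> d" "x \<in> space M"
  shows "mspace (fiber_metric B \<pi> d x) = fiber B \<pi> x"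
    and "mdist (fiber_metric B \<pi> d x) = dist_on (fiber B \<pi> x) d"
  using assms
  by (simp_all add: metric_bundle_def fiber_metric_def Metric_space.mspace_metric
      Metric_space.mdist_metric)

definition borel_section :: "'a measure \<Rightarrow> 'b measure \<Rightarrow> ('b \<Rightarrow> 'a) \<Rightarrow> ('a \<Rightarrow> 'b) \<Rightarrow> bool" where
  "borel_section M B \<pi> s \<longleftrightarrow> s \<in> measurable M B \<and> (\<forall>x\<in>space M. s x \<in> fiber B \<pi> x)"

definition separable_bundle ::
    "'a measure \<Rightarrow> 'b measure \<Rightarrow> ('b \<Rightarrow> 'a) \<Rightarrow> ('b \<Rightarrow> 'b \<Rightarrow> real) \<Rightarrow> bool" where
  "separable_bundle M B \<pi> d \<longleftrightarrow>
     (\<exists>s :: nat \<Rightarrow> 'a \<Rightarrow> 'b.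
        (\<forall>i. borel_section M B \<pi> (s i)) \<and>
        (\<forall>x\<in>space M.
           mtopology_of (fiber_metric B \<pi> d x) closure_of range (\<lambda>i. s i x) = fiber B \<pi> x))"

definition hyperbolic_bundle ::
    "'a measure \<Rightarrow> 'b measure \<Rightarrow> ('b \<Rightarrow> 'a) \<Rightarrow> ('b \<Rightarrow> 'b \<Rightarrow> real) \<Rightarrow> bool" where
  "hyperbolic_bundle M B \<pi> d \<longleftrightarrow>
     metric_bundle M B \<pi> d \<and>
     (\<forall>x\<in>space M. geodesic_metric (fiber_metric B \<pi> d x) \<and>
                   gromov_hyperbolic (fiber_metric B \<pi> d x))"

definition isometric_action ::
    "('a \<times> 'a) set \<Rightarrow> 'b measure \<Rightarrow> ('b \<Rightarrow> 'a) \<Rightarrow> ('b \<Rightarrow> 'b \<Rightarrow> real) \<Rightarrow>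
     ('a \<Rightarrow> 'a \<Rightarrow> 'b \<Rightarrow> 'b) \<Rightarrow> bool" where
  "isometric_action R B \<pi> d \<alpha> \<longleftrightarrow>
     (\<forall>(x, y)\<in>R. bij_betw (\<alpha> x y) (fiber B \<pi> y) (fiber B \<pi> x) \<and>
        (\<forall>p\<in>fiber B \<pi> y. \<forall>q\<in>fiber B \<pi> y. d (\<alpha> x y p) (\<alpha> x y q) = d p q)) \<and>
     (\<forall>x y z. (x, y) \<in> R \<and> (y, z) \<in> R \<longrightarrow>
        (\<forall>p\<in>fiber B \<pi> z. \<alpha> x y (\<alpha> y z p) = \<alpha> x z p)) \<and>
     {(p, q). p \<in> space B \<and> q \<in> space B \<and> (\<pi> p, \<pi> q) \<in> R \<and> \<alpha> (\<pi> p) (\<pi> q) q = p}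
        \<in> sets (B \<Otimes>\<^sub>M B)"


section \<open>Orbits and limit sets\<close>

definition orbit :: "('a \<times> 'a) set \<Rightarrow> ('a \<Rightarrow> 'a \<Rightarrow> 'b \<Rightarrow> 'b) \<Rightarrow> ('a \<Rightarrow> 'b) \<Rightarrow> 'a \<Rightarrow> 'b set" where
  "orbit R \<alpha> s x = (\<lambda>y. \<alpha> x y (s y)) ` (R `` {x})"

text \<open>Points of the orbit are counted with multiplicity: \<open>y \<mapsto> \<alpha>(x, y) s(y)\<close> need not be injective
  on the class of \<open>x\<close>, but only finitely many \<open>y\<close> may be sent to a given ball. Finiteness of the
  intersection of the orbit, as a mere set, with balls is not enough for limit sets to be
  independent of the section: for the trivial action on \<open>X \<times> [0,\<infinity>)\<close>, the section \<open>x \<mapsto> (x, 0)\<close>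
  has one-point orbits, while for \<open>x \<mapsto> (x, f x)\<close> with a Borel \<open>f : X \<rightarrow> \<nat>\<close> all of whose values
  have positive measure, almost every orbit is the set of all naturals.\<close>

definition metrically_proper ::
    "'a measure \<Rightarrow> ('a \<times> 'a) set \<Rightarrow> 'b measure \<Rightarrow> ('b \<Rightarrow> 'a) \<Rightarrow> ('b \<Rightarrow> 'b \<Rightarrow> real) \<Rightarrow>
     ('a \<Rightarrow> 'a \<Rightarrow> 'b \<Rightarrow> 'b) \<Rightarrow> ('a \<Rightarrow> 'b) \<Rightarrow> bool" where
  "metrically_proper M R B \<pi> d \<alpha> s \<longleftrightarrow>
     (\<forall>x\<in>space M. \<forall>p\<in>fiber B \<pi> x. \<forall>r.
        finite {y \<in> R `` {x}. \<alpha> x y (s y) \<in> mball_of (fiber_metric B \<pi> d x) p r})"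

definition orbit_closure ::
    "('a \<times> 'a) set \<Rightarrow> 'b measure \<Rightarrow> ('b \<Rightarrow> 'a) \<Rightarrow> ('b \<Rightarrow> 'b \<Rightarrow> real) \<Rightarrow>
     ('a \<Rightarrow> 'a \<Rightarrow> 'b \<Rightarrow> 'b) \<Rightarrow> ('a \<Rightarrow> 'b) \<Rightarrow> 'a \<Rightarrow> ('b + (nat \<Rightarrow> 'b) set) set" where
  "orbit_closure R B \<pi> d \<alpha> s x =
     gromov_topology (fiber_metric B \<pi> d x) closure_of (Inl ` orbit R \<alpha> s x)"

definition limit_set ::
    "('a \<times> 'a) set \<Rightarrow> 'b measure \<Rightarrow> ('b \<Rightarrow> 'a) \<Rightarrow> ('b \<Rightarrow> 'b \<Rightarrow> real) \<Rightarrow>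
     ('a \<Rightarrow> 'a \<Rightarrow> 'b \<Rightarrow> 'b) \<Rightarrow> ('a \<Rightarrow> 'b) \<Rightarrow> 'a \<Rightarrow> ('b + (nat \<Rightarrow> 'b) set) set" where
  "limit_set R B \<pi> d \<alpha> s x =
     orbit_closure R B \<pi> d \<alpha> s x \<inter> Inr ` gromov_boundary (fiber_metric B \<pi> d x)"

definition proper_section_with_compact_closure ::
    "'a measure \<Rightarrow> ('a \<times> 'a) set \<Rightarrow> 'b measure \<Rightarrow> ('b \<Rightarrow> 'a) \<Rightarrow> ('b \<Rightarrow> 'b \<Rightarrow> real) \<Rightarrow>
     ('a \<Rightarrow> 'a \<Rightarrow> 'b \<Rightarrow> 'b) \<Rightarrow> ('a \<Rightarrow> 'b) \<Rightarrow> bool" where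
  "proper_section_with_compact_closure M R B \<pi> d \<alpha> s \<longleftrightarrow>
     borel_section M B \<pi> s \<and> metrically_proper M R B \<pi> d \<alpha> s \<and>
     (AE x in M. compactin (gromov_topology (fiber_metric B \<pi> d x)) (orbit_closure R B \<pi> d \<alpha> s x))"

definition main_assumption ::
    "'a measure \<Rightarrow> ('a \<times> 'a) set \<Rightarrow> 'b measure \<Rightarrow> ('b \<Rightarrow> 'a) \<Rightarrow> ('b \<Rightarrow> 'b \<Rightarrow> real) \<Rightarrow>
     ('a \<Rightarrow> 'a \<Rightarrow> 'b \<Rightarrow> 'b) \<Rightarrow> bool" where
  "main_assumption M R B \<pi> d \<alpha> \<longleftrightarrow>
     prob_space M \<and> standard_borel M \<and> non_atomic M \<and>
     discrete_borel_equiv M R \<and> invariant_under M R \<and> ergodic_under M R \<and>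
     hyperbolic_bundle M B \<pi> d \<and> separable_bundle M B \<pi> d \<and>
     isometric_action R B \<pi> d \<alpha> \<and>
     (\<exists>s. proper_section_with_compact_closure M R B \<pi> d \<alpha> s)"

end

theory Submission
  imports Defs
begin

text \<open>By symmetry it is enough that almost every limit set of \<open>\<sigma>\<close> is contained in that of \<open>\<eta>\<close>.
  Write \<open>\<sigma>\<^sub>x y = \<alpha>(x, y) \<sigma>(y)\<close>, and send each \<open>y\<close> to a \<open>z\<close> in its class for which \<open>\<eta>\<^sub>y z\<close> is as close
  to \<open>\<sigma> y\<close> as possible; such a \<open>z\<close> exists because \<open>\<eta>\<close> is proper. Since the measure is invariant, this
  map transports the total mass 1, so its fibers have finite average size: almost surely the map is
  finite-to-one on the whole class.

  Now let \<open>\<xi>\<close> be a limit point of the orbit of \<open>\<sigma>\<close> but not of the orbit of \<open>\<eta>\<close>, and take a base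
  point \<open>o\<close> in the orbit of \<open>\<eta>\<close>. The products \<open>(\<xi>|\<eta>\<^sub>x z)\<^sub>o\<close> are then bounded, while \<open>(\<xi>|\<sigma>\<^sub>x y)\<^sub>o\<close> exceeds any
  given bound for infinitely many \<open>y\<close>. For these \<open>y\<close> hyperbolicity bounds \<open>(\<sigma>\<^sub>x y|\<eta>\<^sub>x z)\<^sub>o\<close> by some \<open>T\<close>
  for every \<open>z\<close>. If \<open>\<eta>\<^sub>x z\<close> is nearest to \<open>\<sigma>\<^sub>x y\<close> in its orbit, it is in particular not further from it
  than \<open>o\<close>, and the bound on the product turns into \<open>d(o, \<eta>\<^sub>x z) \<le> 2 T\<close>. By properness only finitely
  many \<open>z\<close> remain, so that one of them is the image of infinitely many \<open>y\<close>, a contradiction. This is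
  \<open>limit_points_through_nearest_points\<close>; the finiteness of the fibers is \<open>finite_to_one_selection\<close>.

  The remaining work is measurability. Invariance speaks only of Borel automorphisms, so
  countably many of them are needed whose graphs exhaust the relation up to a null set
  (\<open>automorphisms_exhaust_equivalence_relation\<close>, a measure-theoretic form of the theorem of Feldman and
  Moore). A proper section makes this elementary: the relations
  \<open>R\<^sub>n = {(x, y). d(\<sigma> x, \<sigma>\<^sub>x y) < n}\<close> are symmetric, have finite sections and exhaust \<open>R\<close>, so any two
  points related by \<open>R\<^sub>n\<close> can be isolated from all their other partners by basic open sets. As the
  action is Borel only through its graph, \<open>R\<^sub>n\<close> is a projection of a Borel set. Such sets are handled
  through the Souslin operation: projections along standard Borel spaces stay within it
  (\<open>souslin_projection\<close>), and the sets that it produces from measurable sets are measurable for the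
  completion of every finite measure (\<open>souslin_sets_completion\<close>).\<close>

section \<open>The Souslin operation\<close>

text \<open>Continuity for the product topology on sequences and the discrete topology on values.
  Stating the Souslin operation through continuous schemes, instead of families indexed by finite
  sequences, lets one sequence code several others without any bookkeeping of lengths.\<close>
definition locally_determined :: "((nat \<Rightarrow> nat) \<Rightarrow> 'a) \<Rightarrow> bool" where
  "locally_determined F \<longleftrightarrow> (\<forall>g. \<exists>m. \<forall>g'. (\<forall>i<m. g' i = g i) \<longrightarrow> F g' = F g)"

lemma locally_determined_const: "locally_determined (\<lambda>g. c)"
  by (auto simp: locally_determined_def)

lemma locally_determined_coordinate: "locally_determined (\<lambda>g. g i)"
  unfolding locally_determined_def by (metis lessI)

lemma locally_determined_bind:
  assumes F: "locally_determined F" and H: "\<And>a. locally_determined (H a)"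
  shows "locally_determined (\<lambda>g. H (F g) g)"
  unfolding locally_determined_def
proof
  fix g
  obtain m where m: "\<And>g'. (\<forall>i<m. g' i = g i) \<Longrightarrow> F g' = F g"
    using F unfolding locally_determined_def by blast
  obtain l where l: "\<And>g'. (\<forall>i<l. g' i = g i) \<Longrightarrow> H (F g) g' = H (F g) g"
    using H unfolding locally_determined_def by blast
  have "H (F g') g' = H (F g) g" if "\<forall>i<max m l. g' i = g i" for g'
  proof -
    have "F g' = F g" by (rule m) (use that in auto)
    moreover have "H (F g) g' = H (F g) g" by (rule l) (use that in auto)
    ultimately show ?thesis by simp
  qed
  then have "\<forall>g'. (\<forall>i<max m l. g' i = g i) \<longrightarrow> H (F g') g' = H (F g) g" by blast
  then show "\<exists>m. \<forall>g'. (\<forall>i<m. g' i = g i) \<longrightarrow> H (F g') g' = H (F g) g" ..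
qed

lemma locally_determined_map: "locally_determined F \<Longrightarrow> locally_determined (\<lambda>g. h (F g))"
  unfolding locally_determined_def by metis

text \<open>Decoding one coordinate sequence from another is continuous, because each decoded
  entry looks at a single entry of the code.\<close>
lemma locally_determined_reindex:
  assumes F: "locally_determined F"
  shows "locally_determined (\<lambda>g. F (\<lambda>i. u (g (v i))))"
  unfolding locally_determined_def
proof
  fix g :: "nat \<Rightarrow> nat"
  obtain m where m: "\<And>g'. (\<forall>i<m. g' i = u (g (v i))) \<Longrightarrow> F g' = F (\<lambda>i. u (g (v i)))"
    using F unfolding locally_determined_def by meson
  define l where "l = Suc (\<Sum>i<m. v i)"
  have "v i < l" if "i < m" for i
    using member_le_sum[of i "{..<m}" v] that by (auto simp: l_def less_Suc_eq_le)
  then have "\<forall>g'. (\<forall>i<l. g' i = g i) \<longrightarrow> F (\<lambda>i. u (g' (v i))) = F (\<lambda>i. u (g (v i)))"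
    by (auto intro!: m)
  then show "\<exists>l. \<forall>g'. (\<forall>i<l. g' i = g i) \<longrightarrow> F (\<lambda>i. u (g' (v i))) = F (\<lambda>i. u (g (v i)))" ..
qed

definition souslin :: "'a set set \<Rightarrow> 'a set set" where
  "souslin P = {E. \<exists>Q. (\<forall>n g. Q n g \<in> P) \<and> (\<forall>n. locally_determined (Q n)) \<and>
                       E = (\<Union>g :: nat \<Rightarrow> nat. \<Inter>n :: nat. Q n g)}"

lemma souslinI:
  fixes Q :: "nat \<Rightarrow> (nat \<Rightarrow> nat) \<Rightarrow> 'a set"
  assumes "\<And>n g. Q n g \<in> P" "\<And>n. locally_determined (Q n)" "E = (\<Union>g. \<Inter>n. Q n g)"
  shows "E \<in> souslin P"
  unfolding souslin_def mem_Collect_eq by (rule exI[of _ Q]) (use assms in simp)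

lemma souslinE:
  assumes "E \<in> souslin P"
  obtains Q :: "nat \<Rightarrow> (nat \<Rightarrow> nat) \<Rightarrow> 'a set"
  where "\<forall>n g. Q n g \<in> P" "\<forall>n. locally_determined (Q n)" "E = (\<Union>g. \<Inter>n. Q n g)"
proof -
  from assms have "\<exists>Q :: nat \<Rightarrow> (nat \<Rightarrow> nat) \<Rightarrow> 'a set.
    (\<forall>n g. Q n g \<in> P) \<and> (\<forall>n. locally_determined (Q n)) \<and> E = (\<Union>g. \<Inter>n. Q n g)"
    unfolding souslin_def by simp
  then show ?thesis
    by (elim exE conjE) (rule that)
qed

lemma souslin_superset: "P \<subseteq> souslin P"
proof
  fix A assume "A \<in> P"
  then show "A \<in> souslin P"
    by (intro souslinI[of "\<lambda>n g. A"]) (auto simp: locally_determined_const)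
qed

lemma souslin_mono: "P \<subseteq> P' \<Longrightarrow> souslin P \<subseteq> souslin P'"
  unfolding souslin_def by blast

text \<open>A witness for membership in a nested scheme is a sequence for the outer scheme together
  with one sequence for each of its countably many conditions; a pairing function packs them into
  one sequence, part 0 being the outer one.\<close>
lemma souslin_idem: "souslin (souslin P) = souslin P"
proof
  show "souslin (souslin P) \<subseteq> souslin P"
  proof
    fix E assume "E \<in> souslin (souslin P)"
    then obtain Q :: "nat \<Rightarrow> (nat \<Rightarrow> nat) \<Rightarrow> 'a set"
      where Q': "\<forall>n g. Q n g \<in> souslin P" "\<forall>n. locally_determined (Q n)"
        and E: "E = (\<Union>g. \<Inter>n. Q n g)"
      by (rule souslinE)
    note Q = Q'[rule_format]
    have "\<exists>W :: nat \<Rightarrow> (nat \<Rightarrow> nat) \<Rightarrow> 'a set. S \<in> souslin P \<longrightarrow>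
        (\<forall>k h. W k h \<in> P) \<and> (\<forall>k. locally_determined (W k)) \<and> S = (\<Union>h. \<Inter>k. W k h)" for S
      by (cases "S \<in> souslin P") (simp_all add: souslin_def)
    then have "\<forall>S. \<exists>W :: nat \<Rightarrow> (nat \<Rightarrow> nat) \<Rightarrow> 'a set. S \<in> souslin P \<longrightarrow>
        (\<forall>k h. W k h \<in> P) \<and> (\<forall>k. locally_determined (W k)) \<and> S = (\<Union>h. \<Inter>k. W k h)"
      by (rule allI)
    from choice[OF this] have "\<exists>W :: 'a set \<Rightarrow> nat \<Rightarrow> (nat \<Rightarrow> nat) \<Rightarrow> 'a set. \<forall>S. S \<in> souslin P \<longrightarrow>
        (\<forall>k h. W S k h \<in> P) \<and> (\<forall>k. locally_determined (W S k)) \<and> S = (\<Union>h. \<Inter>k. W S k h)" .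
    then obtain W :: "'a set \<Rightarrow> nat \<Rightarrow> (nat \<Rightarrow> nat) \<Rightarrow> 'a set"
      where W': "\<forall>S. S \<in> souslin P \<longrightarrow>
        (\<forall>k h. W S k h \<in> P) \<and> (\<forall>k. locally_determined (W S k)) \<and> S = (\<Union>h. \<Inter>k. W S k h)"
      by (rule exE)
    have W: "\<And>S k h. S \<in> souslin P \<Longrightarrow> W S k h \<in> P"
        "\<And>S k. S \<in> souslin P \<Longrightarrow> locally_determined (W S k)"
        "\<And>S. S \<in> souslin P \<Longrightarrow> S = (\<Union>h. \<Inter>k. W S k h)"
      using W' by blast+
    define part where "part n G = (\<lambda>i. G (prod_encode (n, i)))" for n :: nat and G :: "nat \<Rightarrow> nat"
    define V where "V N G = (case prod_decode N of (n, k) \<Rightarrow>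
        W (Q n (part 0 G)) k (part (Suc n) G))" for N G
    show "E \<in> souslin P"
    proof (rule souslinI)
      show "V N G \<in> P" for N G
        by (auto simp: V_def W(1) Q(1) split: prod.split)
      show "locally_determined (V N)" for N
      proof -
        obtain n k where N: "prod_decode N = (n, k)" by fastforce
        define F where "F = (\<lambda>G. Q n (part 0 G))"
        have F: "locally_determined F"
          unfolding part_def F_def
          by (rule locally_determined_reindex[where u="\<lambda>a. a", OF Q(2)])
        have "locally_determined (\<lambda>G. if S \<in> souslin P then W S k (part (Suc n) G) else {})" for S
        proof (cases "S \<in> souslin P")
          case True
          then show ?thesis unfolding part_def
            using locally_determined_reindex[where u="\<lambda>a. a", OF W(2)[OF True]] by simp
        qed (simp add: locally_determined_const)
        then have "locally_determined
            (\<lambda>G. if F G \<in> souslin P then W (F G) k (part (Suc n) G) else {})"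
          by (rule locally_determined_bind[OF F])
        moreover have "V N = (\<lambda>G. if F G \<in> souslin P then W (F G) k (part (Suc n) G) else {})"
          by (auto simp: V_def N F_def Q(1))
        ultimately show ?thesis by simp
      qed
      show "E = (\<Union>G. \<Inter>N. V N G)"
      proof (intro set_eqI iffI)
        fix x assume "x \<in> E"
        then obtain g where "\<forall>n. x \<in> Q n g" using E by blast
        then have "x \<in> (\<Union>h. \<Inter>k. W (Q n g) k h)" for n
          using W(3)[OF Q(1)] by simp
        then have "\<forall>n. \<exists>h. \<forall>k. x \<in> W (Q n g) k h" by simp
        then obtain h where h: "\<And>n k. x \<in> W (Q n g) k (h n)" by metis
        define G where "G = (\<lambda>N. case prod_decode N of (0, i) \<Rightarrow> g i | (Suc n, i) \<Rightarrow> h n i)"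
        have "part 0 G = g" "part (Suc n) G = h n" for n
          by (auto simp: part_def G_def)
        then have "x \<in> V N G" for N
          using h by (cases "prod_decode N") (simp add: V_def)
        then show "x \<in> (\<Union>G. \<Inter>N. V N G)" by blast
      next
        fix x assume "x \<in> (\<Union>G. \<Inter>N. V N G)"
        then obtain G where G: "\<And>N. x \<in> V N G" by blast
        have "x \<in> W (Q n (part 0 G)) k (part (Suc n) G)" for n k
          using G[of "prod_encode (n, k)"] by (simp add: V_def)
        then have "x \<in> Q n (part 0 G)" for n
          using W(3)[OF Q(1)] by blast
        then show "x \<in> E" using E by blast
      qed
    qed
  qed
qed (rule souslin_superset)

lemma souslin_Union:
  assumes "\<And>k::nat. E k \<in> souslin P"
  shows "(\<Union>k. E k) \<in> souslin P"
proof -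
  have "(\<Union>k. E k) \<in> souslin (souslin P)"
  proof (rule souslinI)
    have "x \<in> (\<Union>g::nat \<Rightarrow> nat. E (g 0))" if "x \<in> E k" for x k
      by (rule UN_I[of "\<lambda>_. k"]) (use that in auto)
    then show "(\<Union>k. E k) = (\<Union>g. \<Inter>n::nat. E (g 0))" by auto
    show "locally_determined (\<lambda>g. E (g 0))"
      by (rule locally_determined_map[OF locally_determined_coordinate])
  qed (simp add: assms)
  then show ?thesis by (simp add: souslin_idem)
qed

lemma souslin_Inter:
  assumes "\<And>k::nat. E k \<in> souslin P"
  shows "(\<Inter>k. E k) \<in> souslin P"
proof -
  have "(\<Inter>k. E k) \<in> souslin (souslin P)"
    by (rule souslinI[of "\<lambda>n g. E n"]) (auto simp: locally_determined_const assms)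
  then show ?thesis by (simp add: souslin_idem)
qed

lemma souslin_Int: "A \<in> souslin P \<Longrightarrow> B \<in> souslin P \<Longrightarrow> A \<inter> B \<in> souslin P"
proof -
  assume "A \<in> souslin P" "B \<in> souslin P"
  then have "(\<Inter>k::nat. if k = 0 then A else B) \<in> souslin P"
    by (intro souslin_Inter) auto
  moreover have "(\<Inter>k::nat. if k = 0 then A else B) = A \<inter> B"
    by (auto split: if_splits)
  ultimately show ?thesis by simp
qed

lemma souslin_sets_subset_space: "E \<in> souslin (sets M) \<Longrightarrow> E \<subseteq> space M"
proof
  fix x assume "E \<in> souslin (sets M)" "x \<in> E"
  from this(1) obtain Q :: "nat \<Rightarrow> (nat \<Rightarrow> nat) \<Rightarrow> 'a set"
    where Q': "\<forall>n g. Q n g \<in> sets M" "\<forall>n. locally_determined (Q n)" "E = (\<Union>g. \<Inter>n. Q n g)"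
    by (rule souslinE)
  note Q = Q'(1)[rule_format] and Q'(3)
  with \<open>x \<in> E\<close> obtain g where "x \<in> Q 0 g" by blast
  then show "x \<in> space M" using sets.sets_into_space[OF Q(1)] by blast
qed

lemma souslin_vimage:
  fixes N :: "'b measure"
  assumes E: "E \<in> souslin (sets N)" and f: "f \<in> measurable M N"
  shows "f -` E \<inter> space M \<in> souslin (sets M)"
proof -
  obtain Q :: "nat \<Rightarrow> (nat \<Rightarrow> nat) \<Rightarrow> 'b set"
    where Q': "\<forall>n g. Q n g \<in> sets N" "\<forall>n. locally_determined (Q n)"
      and E: "E = (\<Union>g. \<Inter>n. Q n g)"
    using E by (rule souslinE)
  note Q = Q'[rule_format]
  show ?thesis
  proof (rule souslinI)
    show "f -` Q n g \<inter> space M \<in> sets M" for n g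
      using Q(1) f by (rule measurable_sets[rotated])
    show "locally_determined (\<lambda>g. f -` Q n g \<inter> space M)" for n
      by (rule locally_determined_map[OF Q(2)])
    show "f -` E \<inter> space M = (\<Union>g. \<Inter>n. f -` Q n g \<inter> space M)"
      by (auto simp: E)
  qed
qed

text \<open>Koenig's lemma for the finitely branching tree of sequences bounded by \<open>h\<close>: a prefix
  is good if it extends to solutions of every finite stage, and by the pigeonhole principle good
  prefixes have good extensions.\<close>
lemma koenig_bounded:
  fixes h :: "nat \<Rightarrow> nat"
  assumes cong: "\<And>k g g'. (\<forall>i<k. g' i = g i) \<Longrightarrow> P k g' = P k g"
    and mono: "\<And>k g. P (Suc k) g \<Longrightarrow> P k g"
    and ex: "\<And>k. \<exists>g. (\<forall>i<k. g i \<le> h i) \<and> P k g"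
  shows "\<exists>g. \<forall>k. P k g"
proof -
  define good where "good k f \<longleftrightarrow>
      (\<forall>K\<ge>k. \<exists>g. (\<forall>i<k. g i = f i) \<and> (\<forall>i<K. g i \<le> h i) \<and> P K g)" for k f
  have antimono: "P k g" if "P K g" "k \<le> K" for k K g
    using that(2,1) by (induction rule: dec_induct) (auto dest: mono)
  have step: "\<exists>f'. good (Suc k) f' \<and> (\<forall>i<k. f' i = f i)" if good: "good k f" for k f
  proof (rule ccontr)
    assume no: "\<not> ?thesis"
    have "\<exists>K\<ge>Suc k. \<forall>g. (\<forall>i<Suc k. g i = (f(k := n)) i) \<longrightarrow> (\<forall>i<K. g i \<le> h i) \<longrightarrow> \<not> P K g" for n
    proof -
      have "\<not> good (Suc k) (f(k := n))" using no by auto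
      then show ?thesis unfolding good_def by blast
    qed
    then obtain K where K: "\<And>n. K n \<ge> Suc k"
      "\<And>n g. (\<forall>i<Suc k. g i = (f(k := n)) i) \<Longrightarrow> (\<forall>i<K n. g i \<le> h i) \<Longrightarrow> \<not> P (K n) g"
      by metis
    define L where "L = Max (K ` {..h k})"
    have L: "K n \<le> L" if "n \<le> h k" for n
      using that by (simp add: L_def)
    then have "Suc k \<le> L" using K(1)[of 0] by (meson le0 le_trans)
    then have "\<exists>g. (\<forall>i<k. g i = f i) \<and> (\<forall>i<L. g i \<le> h i) \<and> P L g"
      using good unfolding good_def by simp
    then obtain g where g: "\<forall>i<k. g i = f i" "\<forall>i<L. g i \<le> h i" "P L g"
      by blast
    have "g k \<le> h k" using g(2) \<open>Suc k \<le> L\<close> by simp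
    moreover have "\<forall>i<Suc k. g i = (f(k := g k)) i" using g(1) by (simp add: less_Suc_eq)
    moreover have "K (g k) \<le> L" using L calculation(1) by simp
    moreover from this have "\<forall>i<K (g k). g i \<le> h i" using g(2) by simp
    ultimately show False
      using K(2)[of g "g k"] g(3) antimono[of L g "K (g k)"] by blast
  qed
  obtain F where F: "\<And>k. good k (F k)" "\<And>k. \<forall>i<k. F (Suc k) i = F k i"
  proof -
    have "\<exists>F. \<forall>k. good k (F k) \<and> (\<forall>i<k. F (Suc k) i = F k i)"
    proof (rule dependent_nat_choice)
      show "\<exists>f. good 0 f"
        using ex unfolding good_def by auto
    qed (use step in blast)
    then show ?thesis using that by blast
  qed
  define g where "g i = F (Suc i) i" for i
  have g: "F k i = g i" if "i < k" for i k
  proof -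
    from that have "Suc i \<le> k" by simp
    then show ?thesis
      by (induction rule: dec_induct) (use F(2) in \<open>auto simp: g_def\<close>)
  qed
  have "P k g" for k
  proof -
    obtain g' where "\<forall>i<k. g' i = F k i" "P k g'"
      using F(1)[of k] unfolding good_def by blast
    then show ?thesis using cong[of k g g'] g by auto
  qed
  then show ?thesis by blast
qed

text \<open>The capacity argument. Bounding the coordinates of the witness one after the other costs
  arbitrarily little outer measure, since outer measure is continuous along increasing unions. Once
  every coordinate is bounded, the \<open>k\<close>-th stage of the scheme is a finite union of measurable sets,
  and Koenig's lemma shows that the intersection of the stages still lies in the set.\<close>
lemma (in finite_measure) souslin_inner_approx:
  assumes E: "E \<in> souslin (sets M)" and c: "c < outer_measure_of M E"
  shows "\<exists>K\<in>sets M. K \<subseteq> E \<and> c \<le> emeasure M K"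
proof -
  obtain Q :: "nat \<Rightarrow> (nat \<Rightarrow> nat) \<Rightarrow> 'a set"
    where Q': "\<forall>n g. Q n g \<in> sets M" "\<forall>n. locally_determined (Q n)"
      and EQ: "E = (\<Union>g. \<Inter>n. Q n g)"
    using E by (rule souslinE)
  note Q = Q'[rule_format]
  define det where "det j k g \<longleftrightarrow> (\<forall>g'. (\<forall>i<k. g' i = g i) \<longrightarrow> Q j g' = Q j g)"
    for j k :: nat and g :: "nat \<Rightarrow> nat"
  \<comment> \<open>The first \<open>k\<close> entries of \<open>g\<close> decide the conditions collected in \<open>T k g\<close>, and every condition is
    collected for large \<open>k\<close>.\<close>
  define T where "T k g = space M \<inter> (\<Inter>j\<in>{j. j < k \<and> det j k g}. Q j g)" for k g
  have det_cong: "det j k g' = det j k g" if "\<forall>i<k. g' i = g i" for j k g g'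
  proof -
    have "(\<forall>i<k. f i = g' i) \<longleftrightarrow> (\<forall>i<k. f i = g i)" for f using that by simp
    moreover have "Q j g' = Q j g" if "\<forall>f. (\<forall>i<k. f i = g i) \<longrightarrow> Q j f = Q j g"
      using that \<open>\<forall>i<k. g' i = g i\<close> by blast
    moreover have "Q j g' = Q j g" if "\<forall>f. (\<forall>i<k. f i = g i) \<longrightarrow> Q j f = Q j g'"
      using that[rule_format, of g] by simp
    ultimately show ?thesis unfolding det_def by (simp only:) metis
  qed
  have T_cong: "T k g' = T k g" if eq: "\<forall>i<k. g' i = g i" for k g g'
  proof -
    have "Q j g' = Q j g" if "det j k g" for j
      using that eq unfolding det_def by blast
    then show ?thesis
      unfolding T_def det_cong[OF eq] by auto
  qed
  have T_Suc: "T (Suc k) g \<subseteq> T k g" for k g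
  proof -
    have "det j (Suc k) g" if "det j k g" for j
      unfolding det_def
    proof (intro allI impI)
      fix g' assume "\<forall>i<Suc k. g' i = g i"
      then have "\<forall>i<k. g' i = g i" by simp
      with that show "Q j g' = Q j g" unfolding det_def by blast
    qed
    then have "{j. j < k \<and> det j k g} \<subseteq> {j. j < Suc k \<and> det j (Suc k) g}"
      by auto
    then show ?thesis unfolding T_def by blast
  qed
  have T_Inter: "(\<forall>k. x \<in> T k g) \<longleftrightarrow> (\<forall>j. x \<in> Q j g)" for x g
  proof
    assume x: "\<forall>k. x \<in> T k g"
    show "\<forall>j. x \<in> Q j g"
    proof
      fix j
      obtain m where m: "\<forall>g'. (\<forall>i<m. g' i = g i) \<longrightarrow> Q j g' = Q j g"
        using Q(2) unfolding locally_determined_def by blast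
      have "det j (max m (Suc j)) g" unfolding det_def
      proof (intro allI impI)
        fix g' assume "\<forall>i<max m (Suc j). g' i = g i"
        then have "\<forall>i<m. g' i = g i" by simp
        with m show "Q j g' = Q j g" by blast
      qed
      then show "x \<in> Q j g" using x[rule_format, of "max m (Suc j)"] by (auto simp: T_def)
    qed
  next
    assume x: "\<forall>j. x \<in> Q j g"
    then have "x \<in> space M" using Q(1) sets.sets_into_space by blast
    with x show "\<forall>k. x \<in> T k g" by (auto simp: T_def)
  qed
  have T_sets: "T k g \<in> sets M" for k g
  proof (cases "{j. j < k \<and> det j k g} = {}")
    case True
    show ?thesis unfolding T_def True by simp
  next
    case False
    then show ?thesis unfolding T_def
      by (intro sets.Int sets.finite_INT) (auto simp: Q(1))
  qed
  \<comment> \<open>The points with a witness whose first \<open>k\<close> entries are bounded by \<open>h\<close>.\<close>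
  define S where "S k h = {x. \<exists>g. (\<forall>i<k. g i \<le> h i) \<and> (\<forall>n. x \<in> T n g)}"
    for k and h :: "nat \<Rightarrow> nat"
  have S_space: "S k h \<subseteq> space M" for k h
    unfolding S_def T_def by auto
  have S0: "S 0 h = E" for h
    unfolding S_def EQ by (simp add: T_Inter set_eq_iff)
  have step: "\<exists>h'. c < outer_measure_of M (S (Suc k) h') \<and> (\<forall>i<k. h' i = h i)"
    if "c < outer_measure_of M (S k h)" for k h
  proof -
    have "incseq (\<lambda>n. S (Suc k) (h(k := n)))"
      unfolding S_def
      by (rule incseq_SucI) (auto simp: less_Suc_eq le_SucI)
    moreover have "(\<Union>n. S (Suc k) (h(k := n))) = S k h"
    proof (intro set_eqI iffI)
      fix x assume "x \<in> (\<Union>n. S (Suc k) (h(k := n)))"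
      then obtain n g where "\<forall>i<Suc k. g i \<le> (h(k := n)) i" "\<forall>n. x \<in> T n g"
        unfolding S_def by blast
      moreover from this(1) have "\<forall>i<k. g i \<le> h i" by (auto simp: less_Suc_eq)
      ultimately show "x \<in> S k h" unfolding S_def by blast
    next
      fix x assume "x \<in> S k h"
      then obtain g where "\<forall>i<k. g i \<le> h i" "\<forall>n. x \<in> T n g" unfolding S_def by blast
      then have "x \<in> S (Suc k) (h(k := g k))"
        unfolding S_def by (auto simp: less_Suc_eq intro!: exI[of _ g])
      then show "x \<in> (\<Union>n. S (Suc k) (h(k := n)))" by blast
    qed
    ultimately have "(SUP n. outer_measure_of M (S (Suc k) (h(k := n)))) = outer_measure_of M (S k h)"
      using SUP_outer_measure_of_incseq[of "\<lambda>n. S (Suc k) (h(k := n))" M] S_space by simp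
    with that have "c < (SUP n. outer_measure_of M (S (Suc k) (h(k := n))))" by simp
    then obtain n where "c < outer_measure_of M (S (Suc k) (h(k := n)))"
      unfolding less_SUP_iff by blast
    then show ?thesis by (intro exI[of _ "h(k := n)"]) auto
  qed
  obtain F where F: "\<And>k. c < outer_measure_of M (S k (F k))" "\<And>k. \<forall>i<k. F (Suc k) i = F k i"
  proof -
    have "\<exists>F. \<forall>k. c < outer_measure_of M (S k (F k)) \<and> (\<forall>i<k. F (Suc k) i = F k i)"
    proof (rule dependent_nat_choice)
      show "\<exists>f. c < outer_measure_of M (S 0 f)" using c by (simp add: S0)
    qed (use step in blast)
    then show ?thesis using that by blast
  qed
  define h where "h i = F (Suc i) i" for i
  have h: "F k i = h i" if "i < k" for i k
  proof -
    from that have "Suc i \<le> k" by simp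
    then show ?thesis
      by (induction rule: dec_induct) (use F(2) in \<open>auto simp: h_def\<close>)
  qed
  define K where "K k = (\<Union>g\<in>{g. \<forall>i<k. g i \<le> h i}. T k g)" for k
  \<comment> \<open>Only the first \<open>k\<close> entries of \<open>g\<close> matter for \<open>T k g\<close>, so the union is finite.\<close>
  have K_eq: "K k = (\<Union>g\<in>PiE {..<k} (\<lambda>i. {..h i}). T k g)" for k
  proof -
    have "\<exists>g'\<in>PiE {..<k} (\<lambda>i. {..h i}). x \<in> T k g'"
      if "\<forall>i<k. g i \<le> h i" "x \<in> T k g" for x g
      using that T_cong[of k "restrict g {..<k}" g]
      by (intro bexI[of _ "restrict g {..<k}"]) auto
    then have "K k \<subseteq> (\<Union>g\<in>PiE {..<k} (\<lambda>i. {..h i}). T k g)"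
      unfolding K_def by (intro subsetI UN_iff[THEN iffD2]) (elim UN_E CollectE)
    moreover have "PiE {..<k} (\<lambda>i. {..h i}) \<subseteq> {g. \<forall>i<k. g i \<le> h i}"
      by (auto simp: PiE_iff)
    then have "(\<Union>g\<in>PiE {..<k} (\<lambda>i. {..h i}). T k g) \<subseteq> K k"
      unfolding K_def by (rule UN_mono) simp
    ultimately show ?thesis by (rule subset_antisym)
  qed
  have K_sets: "K k \<in> sets M" for k
    unfolding K_eq by (intro sets.finite_UN finite_PiE) (auto simp: T_sets)
  have K_ge: "c \<le> emeasure M (K k)" for k
  proof -
    have "S k (F k) \<subseteq> K k"
    proof
      fix x assume "x \<in> S k (F k)"
      then obtain g where "\<forall>i<k. g i \<le> F k i" "\<forall>n. x \<in> T n g" unfolding S_def by blast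
      then show "x \<in> K k" unfolding K_def using h by (intro UN_I[of g]) simp_all
    qed
    then have "outer_measure_of M (S k (F k)) \<le> outer_measure_of M (K k)"
      by (rule outer_measure_of_mono)
    also have "\<dots> = emeasure M (K k)" using K_sets by simp
    finally show ?thesis using F(1)[of k] by simp
  qed
  have K_decseq: "decseq K"
    unfolding K_def
  proof (rule decseq_SucI)
    fix k
    show "(\<Union>g\<in>{g. \<forall>i<Suc k. g i \<le> h i}. T (Suc k) g) \<subseteq> (\<Union>g\<in>{g. \<forall>i<k. g i \<le> h i}. T k g)"
      by (rule UN_mono) (use T_Suc in auto)
  qed
  have "c \<le> emeasure M (\<Inter>k. K k)"
  proof -
    have "(INF k. emeasure M (K k)) = emeasure M (\<Inter>k. K k)"
      by (rule INF_emeasure_decseq) (use K_sets K_decseq emeasure_finite in auto)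
    then show ?thesis using K_ge by (metis INF_greatest)
  qed
  moreover have "(\<Inter>k. K k) \<in> sets M" using K_sets by auto
  moreover have "(\<Inter>k. K k) \<subseteq> E"
  proof
    fix x assume x: "x \<in> (\<Inter>k. K k)"
    have "\<exists>g. \<forall>k. x \<in> T k g"
    proof (rule koenig_bounded)
      show "(x \<in> T k g') = (x \<in> T k g)" if "\<forall>i<k. g' i = g i" for k g g'
        using T_cong[OF that] by simp
      show "x \<in> T k g" if "x \<in> T (Suc k) g" for k g using that T_Suc by blast
      show "\<exists>g. (\<forall>i<k. g i \<le> h i) \<and> x \<in> T k g" for k using x by (auto simp: K_def)
    qed
    then show "x \<in> E" using T_Inter EQ by auto
  qed
  ultimately show ?thesis by blast
qed

theorem (in finite_measure) souslin_sets_completion: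
  assumes E: "E \<in> souslin (sets M)"
  shows "E \<in> sets (completion M)"
proof -
  obtain V where V: "V \<in> sets M" "E \<subseteq> V" "outer_measure_of M E = emeasure M V"
    using outer_measure_of_attain[OF souslin_sets_subset_space[OF E]] by auto
  obtain K where K: "K \<in> sets M" "K \<subseteq> E" "emeasure M V \<le> emeasure M K"
  proof (cases "emeasure M V = 0")
    case True
    then show ?thesis using that[of "{}"] by simp
  next
    case False
    then obtain c :: "nat \<Rightarrow> ennreal" where c: "\<And>n::nat. c n < emeasure M V" "c \<longlonglongrightarrow> emeasure M V"
      using approx_from_below_dense_linorder[of 0 "emeasure M V"] by (auto simp: zero_less_iff_neq_zero)
    then have "\<forall>n. \<exists>K\<in>sets M. K \<subseteq> E \<and> c n \<le> emeasure M K"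
      using souslin_inner_approx[OF E] V(3) by simp
    then obtain K where K: "\<And>n. K n \<in> sets M" "\<And>n. K n \<subseteq> E" "\<And>n. c n \<le> emeasure M (K n)"
      by metis
    have "c n \<le> emeasure M (\<Union>n. K n)" for n
    proof -
      have "emeasure M (K n) \<le> emeasure M (\<Union>n. K n)"
        by (rule emeasure_mono) (use K(1) in auto)
      then show ?thesis using K(3)[of n] by simp
    qed
    then have "emeasure M V \<le> emeasure M (\<Union>n. K n)"
      using c(2) by (intro LIMSEQ_le_const2) auto
    then show ?thesis using that[of "\<Union>n. K n"] K by auto
  qed
  have "emeasure M (V - K) = emeasure M V - emeasure M K"
    using K V by (intro emeasure_Diff) (auto simp: emeasure_finite)
  also have "\<dots> = 0" using K(3) by (simp add: diff_eq_0_iff_ennreal emeasure_finite less_top[symmetric])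
  finally have "V - K \<in> null_sets M" using K V by auto
  moreover have "E = K \<union> (E - K)" using K by auto
  ultimately show ?thesis
    using K V by (intro sets_completionI[of E K "E - K" "V - K"]) auto
qed

section \<open>Projections along standard Borel spaces\<close>

definition closed_rectangles :: "'a measure \<Rightarrow> 'b topology \<Rightarrow> ('a \<times> 'b) set set" where
  "closed_rectangles M T = {A \<times> F | A F. A \<in> sets M \<and> closedin T F}"

text \<open>The sets that are Souslin over closed rectangles together with their complement form a
  \<open>\<sigma>\<close>-algebra. It makes both projections measurable, because an open set of a metrizable space is a
  countable union of closed sets, and hence it contains the product \<open>\<sigma>\<close>-algebra.\<close>
lemma sets_pair_subset_souslin_closed_rectangles:
  fixes M :: "'a measure" and Z :: "'b measure"
  assumes T: "metrizable_space T" "topspace T = space Z"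
    and Z: "sets Z = sigma_sets (topspace T) {U. openin T U}"
  shows "sets (M \<Otimes>\<^sub>M Z) \<subseteq> souslin (closed_rectangles M T)"
proof -
  define \<Omega> where "\<Omega> = space M \<times> space Z"
  define P where "P = closed_rectangles M T"
  define \<S> where "\<S> = {E. E \<subseteq> \<Omega> \<and> E \<in> souslin P \<and> \<Omega> - E \<in> souslin P}"
  have rect: "A \<times> F \<in> souslin P" if "A \<in> sets M" "closedin T F" for A F
  proof -
    have "A \<times> F \<in> P" using that by (auto simp: P_def closed_rectangles_def)
    then show ?thesis using souslin_superset by blast
  qed
  have top: "closedin T (space Z)" using T(2) closedin_topspace by metis
  have "sigma_algebra \<Omega> \<S>"
    unfolding sigma_algebra_iff2
  proof (intro conjI ballI allI impI)
    show "\<S> \<subseteq> Pow \<Omega>" by (auto simp: \<S>_def)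
    have "{} \<in> souslin P" using rect[of "{}" "{}"] by simp
    moreover have "\<Omega> \<in> souslin P" unfolding \<Omega>_def using rect[OF _ top] by simp
    ultimately show "{} \<in> \<S>" by (simp add: \<S>_def)
    show "\<Omega> - E \<in> \<S>" if "E \<in> \<S>" for E
      using that by (auto simp: \<S>_def double_diff)
    show "(\<Union>i. E i) \<in> \<S>" if "range E \<subseteq> \<S>" for E :: "nat \<Rightarrow> _"
    proof -
      have E: "E i \<subseteq> \<Omega>" "E i \<in> souslin P" "\<Omega> - E i \<in> souslin P" for i
        using that by (auto simp: \<S>_def)
      have "(\<Union>i. E i) \<in> souslin P" by (rule souslin_Union) (rule E)
      moreover have "(\<Inter>i. \<Omega> - E i) \<in> souslin P" by (rule souslin_Inter) (rule E)
      moreover have "(\<Inter>i. \<Omega> - E i) = \<Omega> - (\<Union>i. E i)" by auto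
      ultimately show ?thesis using E(1) by (auto simp: \<S>_def)
    qed
  qed
  then interpret \<S>: sigma_algebra \<Omega> \<S> .
  define N where "N = measure_of \<Omega> \<S> (\<lambda>_. 0)"
  have N: "space N = \<Omega>" "sets N = \<S>"
    by (simp_all add: N_def \<S>.space_closed space_measure_of_conv \<S>.sets_measure_of_eq)
  have fst: "fst \<in> measurable N M"
  proof (rule measurableI)
    show "fst w \<in> space M" if "w \<in> space N" for w using that by (auto simp: N \<Omega>_def)
    fix A assume A: "A \<in> sets M"
    have "fst -` A \<inter> space N = A \<times> space Z"
      using sets.sets_into_space[OF A] by (auto simp: N \<Omega>_def)
    moreover have "\<Omega> - A \<times> space Z = (space M - A) \<times> space Z" by (auto simp: \<Omega>_def)
    ultimately show "fst -` A \<inter> space N \<in> sets N"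
      using rect[OF A top] rect[OF _ top, of "space M - A"] A sets.sets_into_space[OF A]
      by (auto simp: N \<S>_def \<Omega>_def)
  qed
  have snd: "snd \<in> measurable N Z"
  proof (rule measurable_sigma_sets[OF Z])
    show "{U. openin T U} \<subseteq> Pow (topspace T)" by (auto dest: openin_subset)
    show "snd \<in> space N \<rightarrow> topspace T" by (auto simp: N \<Omega>_def T)
    fix U assume "U \<in> {U. openin T U}"
    then have U: "openin T U" by simp
    then have "U \<subseteq> space Z" using openin_subset T by metis
    then have eq: "snd -` U \<inter> space N = space M \<times> U" by (auto simp: N \<Omega>_def)
    have "fsigma_in T U"
      using T(1) U open_imp_fsigma_in by blast
    then obtain C :: "nat \<Rightarrow> _" where C: "\<And>n. closedin T (C n)" "(\<Union>n. C n) = U"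
      unfolding fsigma_in_ascending by blast
    have "(\<Union>n. space M \<times> C n) \<in> souslin P"
      by (rule souslin_Union) (rule rect, simp, rule C)
    moreover have "(\<Union>n. space M \<times> C n) = space M \<times> U" using C(2) by auto
    moreover have "space M \<times> (topspace T - U) \<in> souslin P"
      by (rule rect) (use U in auto)
    moreover have "\<Omega> - space M \<times> U = space M \<times> (topspace T - U)"
      by (auto simp: \<Omega>_def T)
    ultimately show "snd -` U \<inter> space N \<in> sets N"
      unfolding eq using \<open>U \<subseteq> space Z\<close> by (auto simp: N \<S>_def \<Omega>_def)
  qed
  have "(\<lambda>w. (fst w, snd w)) \<in> measurable N (M \<Otimes>\<^sub>M Z)"
    by (rule measurable_Pair[OF fst snd])
  then have "(\<lambda>w. w) \<in> measurable N (M \<Otimes>\<^sub>M Z)" by simp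
  then have "E \<in> sets N" if "E \<in> sets (M \<Otimes>\<^sub>M Z)" for E
  proof -
    have "(\<lambda>w. w) -` E \<inter> space N \<in> sets N"
      using \<open>(\<lambda>w. w) \<in> measurable N (M \<Otimes>\<^sub>M Z)\<close> that by (rule measurable_sets)
    moreover have "E \<subseteq> space N"
      using sets.sets_into_space[OF that] by (auto simp: N \<Omega>_def space_pair_measure)
    ultimately show ?thesis by (simp add: Int_absorb2)
  qed
  then show ?thesis by (auto simp: N \<S>_def P_def)
qed

lemma locally_determined_finite_Inter:
  assumes "\<And>i. locally_determined (F i)"
  shows "locally_determined (\<lambda>g. \<Inter>i\<le>n::nat. F i g)"
proof (induction n)
  case 0
  then show ?case using assms by simp
next
  case (Suc n)
  have "locally_determined (\<lambda>g. A \<inter> F (Suc n) g)" for A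
    by (rule locally_determined_map[OF assms])
  from locally_determined_bind[OF Suc this]
  show ?case by (simp add: atMost_Suc Int_commute)
qed

text \<open>Over closed rectangles \<open>A \<times> F\<close> the second coordinate can be eliminated. Let the witness
  also choose, for each \<open>n\<close>, a ball of radius \<open>1 / (n + 1)\<close> around a point of a dense sequence. By
  completeness the chosen closed sets have a common point as soon as finitely many of them always
  do, and this is a condition on finitely many entries of the witness alone.\<close>
theorem souslin_projection:
  fixes M :: "'a measure" and Z :: "'b measure"
  assumes Z: "standard_borel Z" and E: "E \<in> souslin (sets (M \<Otimes>\<^sub>M Z))"
  shows "fst ` E \<in> souslin (sets M)"
proof (cases "space Z = {}")
  case True
  have "E \<subseteq> space M \<times> space Z"
    using souslin_sets_subset_space[OF E] by (simp add: space_pair_measure)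
  then have "fst ` E = {}" using True by auto
  then show ?thesis using souslin_superset by auto
next
  case nonempty: False
  obtain T where T: "completely_metrizable_space T" "second_countable T"
      "topspace T = space Z" "sets Z = sigma_sets (topspace T) {U. openin T U}"
    using Z unfolding standard_borel_def by blast
  obtain S d where S: "Metric_space S d" "Metric_space.mcomplete S d" "T = Metric_space.mtopology S d"
    using T(1) unfolding completely_metrizable_space_def by blast
  interpret Metric_space S d by (rule S)
  have TS: "topspace T = S" by (simp add: S)
  obtain c :: "nat \<Rightarrow> 'b" where c: "\<And>z r. z \<in> S \<Longrightarrow> 0 < r \<Longrightarrow> \<exists>i. z \<in> mcball (c i) r"
  proof -
    obtain D where D: "countable D" "D \<subseteq> topspace T" "T closure_of D = topspace T"
      using second_countable_imp_separable_space[OF T(2)] unfolding separable_space_def by blast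
    have "D \<noteq> {}" using D(3) nonempty T(3) by auto
    have "\<exists>i. z \<in> mcball (from_nat_into D i) r" if "z \<in> S" "0 < r" for z r
    proof -
      have "z \<in> mtopology closure_of D" using that D(3) S TS by simp
      then have "\<exists>y\<in>D. y \<in> mball z r"
        using that by (simp add: metric_closure_of)
      then obtain y where "y \<in> D" "y \<in> mball z r" by blast
      then have "z \<in> mcball y r" by (auto simp: in_mball in_mcball commute)
      then show ?thesis
        using from_nat_into_surj[OF D(1) \<open>y \<in> D\<close>] by metis
    qed
    then show ?thesis by (rule that)
  qed
  have "E \<in> souslin (souslin (closed_rectangles M T))"
    using E souslin_mono[OF sets_pair_subset_souslin_closed_rectangles[OF _ T(3,4), of M]]
      completely_metrizable_imp_metrizable_space[OF T(1)] by blast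
  then have "E \<in> souslin (closed_rectangles M T)" by (simp add: souslin_idem)
  then obtain Q :: "nat \<Rightarrow> (nat \<Rightarrow> nat) \<Rightarrow> ('a \<times> 'b) set"
    where Q': "\<forall>n g. Q n g \<in> closed_rectangles M T" "\<forall>n. locally_determined (Q n)"
      and EQ: "E = (\<Union>g. \<Inter>n. Q n g)"
    by (rule souslinE)
  note Q = Q'[rule_format]
  have "\<forall>r. \<exists>A F. r \<in> closed_rectangles M T \<longrightarrow> r = A \<times> F \<and> A \<in> sets M \<and> closedin T F"
    by (auto simp: closed_rectangles_def)
  then obtain a b where "\<forall>r. r \<in> closed_rectangles M T \<longrightarrow>
      r = a r \<times> b r \<and> a r \<in> sets M \<and> closedin T (b r)"
    by metis
  then have QAB: "Q n g = a (Q n g) \<times> b (Q n g)" "a (Q n g) \<in> sets M" "closedin T (b (Q n g))" for n g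
    using Q(1) by blast+
  \<comment> \<open>Entry \<open>i\<close> of \<open>G\<close> codes entry \<open>i\<close> of the given scheme's witness and the index of a centre.\<close>
  define l where "l G = (\<lambda>i. fst (prod_decode (G i)))" for G :: "nat \<Rightarrow> nat"
  define r where "r G = (\<lambda>i. snd (prod_decode (G i)))" for G :: "nat \<Rightarrow> nat"
  define C where "C n G = b (Q n (l G)) \<inter> mcball (c (r G n)) (1 / Suc n)" for n G
  define V where "V n G = (if (\<Inter>i\<le>n. C i G) \<noteq> {} then a (Q n (l G)) else {})" for n G
  have Q_l: "locally_determined (\<lambda>G. Q n (l G))" for n
    unfolding l_def
    by (rule locally_determined_reindex[where v="\<lambda>i. i", OF Q(2)])
  have C_loc: "locally_determined (C n)" for n
  proof -
    have "locally_determined (\<lambda>G. X \<inter> mcball (c (r G n)) (1 / Suc n))" for X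
      unfolding r_def by (rule locally_determined_map[OF locally_determined_coordinate])
    from locally_determined_bind[OF locally_determined_map[OF Q_l] this]
    show ?thesis unfolding C_def by simp
  qed
  have C_closed: "closedin mtopology (C n G)" for n G
    unfolding C_def using QAB(3) S(3) by auto
  show ?thesis
  proof (rule souslinI)
    show "V n G \<in> sets M" for n G by (simp add: V_def QAB(2))
    show "locally_determined (V n)" for n
    proof -
      have "locally_determined (\<lambda>G. if X \<noteq> {} then a (Q n (l G)) else {})" for X :: "'b set"
        by (rule locally_determined_map[OF Q_l])
      from locally_determined_bind[OF locally_determined_finite_Inter[OF C_loc] this]
      show ?thesis unfolding V_def .
    qed
    show "fst ` E = (\<Union>G. \<Inter>n. V n G)"
    proof (intro set_eqI iffI)
      fix x assume "x \<in> fst ` E"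
      then obtain z g where z: "\<forall>n. (x, z) \<in> Q n g" using EQ by auto
      then have z': "x \<in> a (Q n g)" "z \<in> b (Q n g)" for n using QAB(1) by blast+
      then have "z \<in> S" using closedin_subset[OF QAB(3)] TS by blast
      then have "\<forall>n. \<exists>i. z \<in> mcball (c i) (1 / Suc n)" using c by simp
      then obtain h where h: "\<And>n. z \<in> mcball (c (h n)) (1 / Suc n)" by metis
      define G where "G i = prod_encode (g i, h i)" for i
      have "l G = g" "r G = h" by (simp_all add: G_def l_def r_def)
      then have "z \<in> C n G" for n using h z' by (simp add: C_def)
      then have "(\<Inter>i\<le>n. C i G) \<noteq> {}" for n by blast
      then have "x \<in> V n G" for n using z' by (simp add: V_def \<open>l G = g\<close>)
      then show "x \<in> (\<Union>G. \<Inter>n. V n G)" by blast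
    next
      fix x assume "x \<in> (\<Union>G. \<Inter>n. V n G)"
      then obtain G where "\<And>n. x \<in> V n G" by blast
      then have G: "(\<Inter>i\<le>n. C i G) \<noteq> {}" "x \<in> a (Q n (l G))" for n
        unfolding V_def by (metis empty_iff)+
      have "\<Inter> (range (\<lambda>n. \<Inter>i\<le>n. C i G)) \<noteq> {}"
        using S(2) unfolding mcomplete_nest
      proof (rule allE[where x="\<lambda>n. \<Inter>i\<le>n. C i G"], elim mp, intro conjI allI impI)
        show "closedin mtopology (\<Inter>i\<le>n. C i G)" for n
          by (rule closedin_INT) (auto simp: C_closed)
        show "(\<Inter>i\<le>n. C i G) \<noteq> {}" for n by (rule G)
        show "decseq (\<lambda>n. \<Inter>i\<le>n. C i G)"
          by (rule decseq_SucI) auto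
        fix e :: real assume "0 < e"
        then obtain n where "1 / Suc n < e" by (metis nat_approx_posE)
        have "(\<Inter>i\<le>n. C i G) \<subseteq> mcball (c (r G n)) (1 / Suc n)" by (auto simp: C_def)
        also have "\<dots> \<subseteq> mcball (c (r G n)) e" using \<open>1 / Suc n < e\<close> by (intro mcball_subset_concentric) simp
        finally show "\<exists>n a. (\<Inter>i\<le>n. C i G) \<subseteq> mcball a e" by blast
      qed
      then obtain z where "\<And>n. z \<in> C n G" by blast
      then have "(x, z) \<in> Q n (l G)" for n
        using G(2) QAB(1)[of n "l G"] by (auto simp: C_def)
      then have "(x, z) \<in> E" unfolding EQ by blast
      then show "x \<in> fst ` E" by force
    qed
  qed
qed

section \<open>Automorphisms exhausting an equivalence relation\<close>

text \<open>A sequence of sets generating the measurable sets which isolates any two points from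
  each other and from finitely many others: what remains of a Hausdorff second countable topology
  once only its \<open>\<sigma>\<close>-algebra is given.\<close>
definition separating_base :: "'a measure \<Rightarrow> (nat \<Rightarrow> 'a set) \<Rightarrow> bool" where
  "separating_base M U \<longleftrightarrow> sets M = sigma_sets (space M) (range U) \<and>
     (\<forall>x\<in>space M. \<forall>y\<in>space M. \<forall>F G. x \<noteq> y \<and> finite F \<and> finite G \<and> x \<notin> F \<and> y \<notin> G \<longrightarrow>
       (\<exists>m n. x \<in> U m \<and> y \<in> U n \<and> U m \<inter> U n = {} \<and> U m \<inter> F = {} \<and> U n \<inter> G = {}))"

lemma separating_base_sets:
  "separating_base M U \<Longrightarrow> U n \<in> sets M"
  by (simp add: separating_base_def sigma_sets.Basic)

lemma separating_baseE:
  assumes "separating_base M U" "x \<in> space M" "y \<in> space M" "x \<noteq> y"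
    "finite F" "finite G" "x \<notin> F" "y \<notin> G"
  obtains m n where "x \<in> U m" "y \<in> U n" "U m \<inter> U n = {}" "U m \<inter> F = {}" "U n \<inter> G = {}"
proof -
  have "\<exists>m n. x \<in> U m \<and> y \<in> U n \<and> U m \<inter> U n = {} \<and> U m \<inter> F = {} \<and> U n \<inter> G = {}"
    using assms unfolding separating_base_def by simp
  then show ?thesis using that by blast
qed

lemma ex_separating_base:
  assumes "standard_borel M"
  shows "\<exists>U. separating_base M U"
proof -
  obtain T where T: "completely_metrizable_space T" "second_countable T"
      "topspace T = space M" "sets M = sigma_sets (topspace T) {U. openin T U}"
    using assms unfolding standard_borel_def by blast
  have haus: "Hausdorff_space T"
    using T(1) completely_metrizable_imp_metrizable_space metrizable_imp_Hausdorff_space by blast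
  obtain \<B> where \<B>: "countable \<B>" "\<And>V. V \<in> \<B> \<Longrightarrow> openin T V"
    "\<And>U x. openin T U \<Longrightarrow> x \<in> U \<Longrightarrow> \<exists>V\<in>\<B>. x \<in> V \<and> V \<subseteq> U"
    using T(2) unfolding second_countable_def by metis
  define U where "U = from_nat_into (insert {} \<B>)"
  have range_U: "range U = insert {} \<B>"
    unfolding U_def using \<B>(1) by (simp add: range_from_nat_into)
  have U_open: "openin T (U n)" for n
    using range_U \<B>(2) by (metis insertE openin_empty rangeI)
  have U_base: "\<exists>n. x \<in> U n \<and> U n \<subseteq> V" if "openin T V" "x \<in> V" for x V
    using \<B>(3)[OF that] range_U by (metis image_iff insertCI)
  have U_sets: "U n \<in> sets M" for n
    unfolding T(4) using U_open by (auto intro: sigma_sets.Basic)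
  have "separating_base M U"
    unfolding separating_base_def
  proof (intro conjI ballI allI impI; (elim conjE)?)
    show "sets M = sigma_sets (space M) (range U)"
    proof
      show "sigma_sets (space M) (range U) \<subseteq> sets M"
        using U_sets by (intro sets.sigma_sets_subset) auto
      have "V \<in> sigma_sets (space M) (range U)" if "openin T V" for V
      proof -
        have "V = (\<Union>n\<in>{n. U n \<subseteq> V}. U n)" using U_base[OF that] by blast
        moreover have "(\<Union>n\<in>{n. U n \<subseteq> V}. U n) \<in> sigma_sets (space M) (range U)"
          by (rule sigma_sets_UNION) (auto intro: sigma_sets.Basic)
        ultimately show ?thesis by simp
      qed
      then show "sets M \<subseteq> sigma_sets (space M) (range U)"
        unfolding T(3,4) by (intro sigma_sets_mono) auto
    qed
    fix x y F G assume xy: "x \<in> space M" "y \<in> space M" "x \<noteq> y"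
      and FG: "finite F" "finite G" "x \<notin> F" "y \<notin> G"
    obtain V W where VW: "openin T V" "openin T W" "x \<in> V" "y \<in> W" "disjnt V W"
      using haus xy T(3) unfolding Hausdorff_space_def by metis
    have closed: "closedin T (topspace T \<inter> F)" "closedin T (topspace T \<inter> G)"
      using FG Hausdorff_imp_t1_space[OF haus] unfolding t1_space_closedin_finite by auto
    have "openin T (V - topspace T \<inter> F)" "openin T (W - topspace T \<inter> G)"
      using VW closed by (auto intro: openin_diff)
    then obtain m n where mn: "x \<in> U m" "U m \<subseteq> V - topspace T \<inter> F"
        "y \<in> U n" "U n \<subseteq> W - topspace T \<inter> G"
      using U_base VW FG by (metis DiffI Int_iff)
    have "U m \<subseteq> topspace T" "U n \<subseteq> topspace T" using U_open openin_subset by blast+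
    then have "U m \<inter> U n = {}" "U m \<inter> F = {}" "U n \<inter> G = {}"
      using mn VW(5) by (auto simp: disjnt_def)
    then show "\<exists>m n. x \<in> U m \<and> y \<in> U n \<and> U m \<inter> U n = {} \<and> U m \<inter> F = {} \<and> U n \<inter> G = {}"
      using mn by blast
  qed
  then show ?thesis by blast
qed

lemma standard_borel_diagonal_complement:
  assumes "standard_borel M"
  shows "{(x, y). x \<in> space M \<and> y \<in> space M \<and> x \<noteq> y} \<in> sets (M \<Otimes>\<^sub>M M)"
proof -
  obtain U where sep: "separating_base M U" using ex_separating_base[OF assms] ..
  note U = separating_base_sets[OF sep]
  have "{(x, y). x \<in> space M \<and> y \<in> space M \<and> x \<noteq> y}
      = (\<Union>(m, n)\<in>{(m, n). U m \<inter> U n = {}}. U m \<times> U n)" (is "?L = ?R")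
  proof
    show "?L \<subseteq> ?R"
    proof clarify
      fix x y assume "x \<in> space M" "y \<in> space M" "x \<noteq> y"
      then obtain m n where "x \<in> U m" "y \<in> U n" "U m \<inter> U n = {}"
        using separating_baseE[OF sep, of x y "{}" "{}"] by auto
      then show "(x, y) \<in> ?R" by auto
    qed
    show "?R \<subseteq> ?L" using sets.sets_into_space[OF U] by blast
  qed
  also have "\<dots> \<in> sets (M \<Otimes>\<^sub>M M)"
    by (rule sets.countable_UN') (auto simp: U)
  finally show ?thesis .
qed

lemma sets_completion_inner:
  assumes "A \<in> sets (completion M)"
  obtains L N where "L \<in> sets M" "N \<in> null_sets M" "L \<subseteq> A" "A - L \<subseteq> N"
  using assms by (elim sets_completionE) blast

text \<open>The domain of the selection is a difference of two projections, and the preimage of a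
  measurable set is the intersection of the domain with another projection. For the sets of a
  countable generator, all of these become measurable after removal of a single null set.
  The measure \<open>\<nu>\<close> is arbitrary because the selection is later needed off a null set of an image
  measure.\<close>
lemma measurable_unique_selection:
  fixes M \<nu> :: "'a measure"
  assumes M: "standard_borel M" and E: "E \<in> souslin (sets (M \<Otimes>\<^sub>M M))"
    and \<nu>: "finite_measure \<nu>" "sets \<nu> = sets M"
  shows "\<exists>D\<in>sets M. D \<subseteq> {x. \<exists>!y. (x, y) \<in> E} \<and>
      (\<lambda>x. THE y. (x, y) \<in> E) \<in> measurable (restrict_space M D) M \<and>
      (\<exists>N\<in>null_sets \<nu>. {x. \<exists>!y. (x, y) \<in> E} - D \<subseteq> N)"
proof -
  interpret \<nu>: finite_measure \<nu> by fact
  define f where "f x = (THE y. (x, y) \<in> E)" for x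
  define U where "U = {x. \<exists>!y. (x, y) \<in> E}"
  have f: "(x, f x) \<in> E" if "x \<in> U" for x
    unfolding f_def by (rule theI') (use that in \<open>simp add: U_def\<close>)
  have compl: "S \<in> sets (completion \<nu>)" if "S \<in> souslin (sets M)" for S
    using \<nu>.souslin_sets_completion that by (simp add: \<nu>)
  have E_space: "E \<subseteq> space M \<times> space M"
    using souslin_sets_subset_space[OF E] by (simp add: space_pair_measure)
  have U_sets: "U \<in> sets (completion \<nu>)"
  proof -
    define MMM where "MMM = (M \<Otimes>\<^sub>M M) \<Otimes>\<^sub>M M"
    have fst: "fst \<in> measurable MMM (M \<Otimes>\<^sub>M M)"
      and pr: "(\<lambda>w. (fst (fst w), snd w)) \<in> measurable MMM (M \<Otimes>\<^sub>M M)"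
      and pr': "(\<lambda>w. (snd (fst w), snd w)) \<in> measurable MMM (M \<Otimes>\<^sub>M M)"
      unfolding MMM_def by measurable
    \<comment> \<open>Projecting twice gives the points with at least two partners.\<close>
    define E2 where "E2 = (fst -` E \<inter> space MMM) \<inter>
      (((\<lambda>w. (fst (fst w), snd w)) -` E \<inter> space MMM) \<inter>
       ((\<lambda>w. (snd (fst w), snd w)) -` {(x, y). x \<in> space M \<and> y \<in> space M \<and> x \<noteq> y} \<inter> space MMM))"
    have "E2 \<in> souslin (sets MMM)"
      unfolding E2_def
      by (intro souslin_Int souslin_vimage[OF E fst] souslin_vimage[OF E pr] souslin_vimage[OF _ pr']
          subsetD[OF souslin_superset] standard_borel_diagonal_complement M)
    then have "fst ` E2 \<in> souslin (sets (M \<Otimes>\<^sub>M M))"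
      unfolding MMM_def by (rule souslin_projection[OF M])
    then have E2: "fst ` fst ` E2 \<in> souslin (sets M)" by (rule souslin_projection[OF M])
    have "U = fst ` E - fst ` fst ` E2"
    proof (intro set_eqI iffI)
      fix x assume "x \<in> U"
      then show "x \<in> fst ` E - fst ` fst ` E2"
        unfolding U_def E2_def by force
    next
      fix x assume x: "x \<in> fst ` E - fst ` fst ` E2"
      then obtain y where y: "(x, y) \<in> E" by force
      have "y' = y" if "(x, y') \<in> E" for y'
      proof (rule ccontr)
        assume "y' \<noteq> y"
        then have "((x, y), y') \<in> E2"
          using y that E_space by (auto simp: E2_def MMM_def space_pair_measure)
        then have "x \<in> fst ` fst ` E2" by force
        then show False using x by blast
      qed
      then show "x \<in> U" using y unfolding U_def by blast
    qed
    then show ?thesis using compl[OF E2] compl[OF souslin_projection[OF M E]] by auto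
  qed
  obtain B where sep: "separating_base M B" using ex_separating_base[OF M] ..
  then have B: "B n \<in> sets M" "sets M = sigma_sets (space M) (range B)" for n
    by (rule separating_base_sets) (use sep in \<open>simp add: separating_base_def\<close>)
  define V where "V n = U \<inter> fst ` (E \<inter> space M \<times> B n)" for n
  have V: "V n = {x \<in> U. f x \<in> B n}" for n
  proof (intro set_eqI iffI)
    fix x assume "x \<in> V n"
    then obtain y where "x \<in> U" "(x, y) \<in> E" "y \<in> B n" unfolding V_def by auto
    moreover from this(1,2) have "f x = y" using f unfolding U_def by blast
    ultimately show "x \<in> {x \<in> U. f x \<in> B n}" by simp
  next
    fix x assume "x \<in> {x \<in> U. f x \<in> B n}"
    then have "x \<in> U" "(x, f x) \<in> E \<inter> space M \<times> B n" using f E_space by auto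
    then show "x \<in> V n" unfolding V_def by force
  qed
  have V_sets: "V n \<in> sets (completion \<nu>)" for n
  proof -
    have "space M \<times> B n \<in> sets (M \<Otimes>\<^sub>M M)" using B(1) by simp
    then have "E \<inter> space M \<times> B n \<in> souslin (sets (M \<Otimes>\<^sub>M M))"
      using souslin_superset by (intro souslin_Int E) blast
    then show ?thesis
      unfolding V_def using compl[OF souslin_projection[OF M]] U_sets by blast
  qed
  obtain L0 N0 where L0: "L0 \<in> sets \<nu>" "N0 \<in> null_sets \<nu>" "L0 \<subseteq> U" "U - L0 \<subseteq> N0"
    using sets_completion_inner[OF U_sets] by metis
  have "\<forall>n. \<exists>L N. L \<in> sets \<nu> \<and> N \<in> null_sets \<nu> \<and> L \<subseteq> V n \<and> V n - L \<subseteq> N"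
    using sets_completion_inner[OF V_sets] by metis
  then obtain L N where LN: "\<And>n. L n \<in> sets \<nu>" "\<And>n. N n \<in> null_sets \<nu>" "\<And>n. L n \<subseteq> V n"
      "\<And>n. V n - L n \<subseteq> N n"
    by metis
  define D where "D = L0 - (\<Union>n. N n)"
  have "(\<Union>n. N n) \<in> null_sets \<nu>" using LN(2) by auto
  then have null: "N0 \<union> (\<Union>n. N n) \<in> null_sets \<nu>" using L0(2) by (rule null_sets.Un[rotated])
  have "D \<in> sets \<nu>" unfolding D_def using L0(1) LN(2) by blast
  then have D: "D \<in> sets M" by (simp add: \<nu>(2))
  have DU: "D \<subseteq> U" using L0(3) by (auto simp: D_def)
  have "f \<in> measurable (restrict_space M D) M"
  proof (rule measurable_sigma_sets[OF B(2)])
    show "range B \<subseteq> Pow (space M)" using sets.sets_into_space[OF B(1)] by auto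
    show "f \<in> space (restrict_space M D) \<rightarrow> space M"
      using f DU E_space by (auto simp: space_restrict_space)
    fix S assume "S \<in> range B"
    then obtain n where n: "S = B n" by blast
    have "f -` S \<inter> space (restrict_space M D) = L n \<inter> D"
      using LN(3,4)[of n] DU D sets.sets_into_space[OF D] unfolding n V
      by (auto simp: space_restrict_space D_def)
    then show "f -` S \<inter> space (restrict_space M D) \<in> sets (restrict_space M D)"
      using LN(1) D \<nu>(2) by (simp add: sets_restrict_space_iff)
  qed
  moreover have "U - D \<subseteq> N0 \<union> (\<Union>n. N n)" using L0(4) by (auto simp: D_def)
  ultimately show ?thesis using D DU null unfolding U_def f_def by blast
qed

lemma sets_Collect_partial_map:
  assumes f: "f \<in> measurable (restrict_space M D) N" and D: "D \<in> sets M" and S: "S \<in> sets N"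
  shows "{x \<in> D. f x \<in> S} \<in> sets M"
proof -
  have "f -` S \<inter> space (restrict_space M D) \<in> sets (restrict_space M D)"
    using f S by (rule measurable_sets)
  moreover have "f -` S \<inter> space (restrict_space M D) = {x \<in> D. f x \<in> S}"
    using sets.sets_into_space[OF D] by (auto simp: space_restrict_space)
  ultimately show ?thesis using D by (simp add: sets_restrict_space_iff)
qed

text \<open>The automorphism exchanges \<open>x \<in> A\<close> and \<open>y \<in> B\<close> whenever they are each other's only
  partner. Each direction of this exchange is a unique selection, and is Borel only on part of its
  domain: on \<open>D\<close> for the direction from \<open>A\<close>, on \<open>F\<close> for the direction from \<open>B\<close>. Only points with
  \<open>x \<in> D\<close> and \<open>y \<in> F\<close> are exchanged, so \<open>F\<close> has to be large for the image of the measure under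
  the first selection: that a set of \<open>y\<close> is null does not yet imply that the corresponding \<open>x\<close> form
  a null set.\<close>
lemma automorphism_from_unique_partners:
  fixes M :: "'a measure"
  assumes M: "prob_space M" "standard_borel M" and R: "equiv (space M) R"
    and C: "C \<in> souslin (sets (M \<Otimes>\<^sub>M M))" "C \<subseteq> R" "sym C"
    and AB: "A \<in> sets M" "B \<in> sets M" "A \<inter> B = {}"
  shows "\<exists>\<phi>. borel_automorphism M \<phi> \<and> (\<forall>x\<in>space M. (x, \<phi> x) \<in> R) \<and>
     (AE x in M. \<forall>y. x \<in> A \<and> C `` {x} \<inter> B = {y} \<and> C `` {y} \<inter> A = {x} \<longrightarrow> \<phi> x = y)"
proof -
  interpret prob_space M by fact
  define E1 where "E1 = C \<inter> A \<times> B"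
  define E2 where "E2 = C \<inter> B \<times> A"
  have "A \<times> B \<in> sets (M \<Otimes>\<^sub>M M)" "B \<times> A \<in> sets (M \<Otimes>\<^sub>M M)" using AB by auto
  then have E: "E1 \<in> souslin (sets (M \<Otimes>\<^sub>M M))" "E2 \<in> souslin (sets (M \<Otimes>\<^sub>M M))"
    unfolding E1_def E2_def using souslin_superset by (blast intro: souslin_Int C)+
  have E12: "(x, y) \<in> E1 \<longleftrightarrow> (y, x) \<in> E2" for x y
    using C(3) by (auto simp: E1_def E2_def sym_def)
  define f where "f x = (THE y. (x, y) \<in> E1)" for x
  define g where "g x = (THE y. (x, y) \<in> E2)" for x
  obtain D N1 where D: "D \<in> sets M" "D \<subseteq> {x. \<exists>!y. (x, y) \<in> E1}"
      "f \<in> measurable (restrict_space M D) M" "N1 \<in> null_sets M" "{x. \<exists>!y. (x, y) \<in> E1} - D \<subseteq> N1"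
    using measurable_unique_selection[OF M(2) E(1) finite_measure_axioms refl] unfolding f_def by blast
  define \<nu> where "\<nu> = distr (restrict_space M D) M f"
  have "finite_measure (restrict_space M D)"
    using D(1) by (intro finite_measure_restrict_space) auto
  then have \<nu>: "finite_measure \<nu>" "sets \<nu> = sets M"
    unfolding \<nu>_def using D(3) by (auto intro: finite_measure.finite_measure_distr)
  obtain F N2 where F: "F \<in> sets M" "F \<subseteq> {x. \<exists>!y. (x, y) \<in> E2}"
      "g \<in> measurable (restrict_space M F) M" "N2 \<in> null_sets \<nu>" "{x. \<exists>!y. (x, y) \<in> E2} - F \<subseteq> N2"
    using measurable_unique_selection[OF M(2) E(2) \<nu>] unfolding g_def by blast
  have fE: "(x, f x) \<in> E1" if "x \<in> D" for x
    unfolding f_def by (rule theI') (use that D(2) in auto)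
  have gE: "(x, g x) \<in> E2" if "x \<in> F" for x
    unfolding g_def by (rule theI') (use that F(2) in auto)
  have f_eq: "f x = y" if "(x, y) \<in> E1" "x \<in> D" for x y
    using that fE D(2) by blast
  have g_eq: "g x = y" if "(x, y) \<in> E2" "x \<in> F" for x y
    using that gE F(2) by blast
  define D' where "D' = {x \<in> D. f x \<in> F}"
  define F' where "F' = {y \<in> F. g y \<in> D}"
  have pre: "{x \<in> D. f x \<in> S} \<in> sets M" if "S \<in> sets M" for S
    by (rule sets_Collect_partial_map[OF D(3,1) that])
  have preg: "{x \<in> F. g x \<in> S} \<in> sets M" if "S \<in> sets M" for S
    by (rule sets_Collect_partial_map[OF F(3,1) that])
  have D': "D' \<in> sets M" and F': "F' \<in> sets M"
    unfolding D'_def F'_def using pre[OF F(1)] preg[OF D(1)] by auto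
  have fD': "f x \<in> F'" "g (f x) = x" if "x \<in> D'" for x
  proof -
    have x: "x \<in> D" "f x \<in> F" using that by (auto simp: D'_def)
    then show "g (f x) = x" using fE g_eq E12 by blast
    then show "f x \<in> F'" using x by (auto simp: F'_def)
  qed
  have gF': "g y \<in> D'" "f (g y) = y" if "y \<in> F'" for y
  proof -
    have y: "y \<in> F" "g y \<in> D" using that by (auto simp: F'_def)
    then show "f (g y) = y" using gE f_eq E12 by blast
    then show "g y \<in> D'" using y by (auto simp: D'_def)
  qed
  have disj: "D' \<inter> F' = {}"
    using fE gE AB(3) unfolding D'_def F'_def E1_def E2_def by blast
  have sub: "D' \<subseteq> space M" "F' \<subseteq> space M" using D' F' sets.sets_into_space by auto
  define \<phi> where "\<phi> x = (if x \<in> D' then f x else if x \<in> F' then g x else x)" for x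
  have \<phi>\<phi>: "\<phi> (\<phi> x) = x" for x
    using fD' gF' disj unfolding \<phi>_def by auto
  have \<phi>_space: "\<phi> x \<in> space M" if "x \<in> space M" for x
    using that fD' gF' sub unfolding \<phi>_def by auto
  have \<phi>_meas: "\<phi> \<in> measurable M M"
  proof (rule measurableI)
    fix S assume S: "S \<in> sets M"
    have "\<phi> -` S \<inter> space M = D' \<inter> {x \<in> D. f x \<in> S} \<union> (F' \<inter> {x \<in> F. g x \<in> S} \<union> (S - D' - F'))"
      using sub disj sets.sets_into_space[OF S] unfolding \<phi>_def
      by (auto simp: D'_def F'_def split: if_splits)
    also have "\<dots> \<in> sets M" using pre[OF S] preg[OF S] D' F' S by auto
    finally show "\<phi> -` S \<inter> space M \<in> sets M" .
  qed (rule \<phi>_space)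
  have bij: "bij_betw \<phi> (space M) (space M)"
    by (rule bij_betw_byWitness[of _ \<phi>]) (auto simp: \<phi>\<phi> \<phi>_space)
  have "the_inv_into (space M) \<phi> \<in> measurable M M \<longleftrightarrow> \<phi> \<in> measurable M M"
  proof (rule measurable_cong)
    fix x assume "x \<in> space M"
    then show "the_inv_into (space M) \<phi> x = \<phi> x"
      using bij \<phi>\<phi> \<phi>_space by (intro the_inv_into_f_eq) (auto simp: bij_betw_def)
  qed
  then have aut: "borel_automorphism M \<phi>"
    unfolding borel_automorphism_def using \<phi>_meas bij by simp
  have graph: "(x, \<phi> x) \<in> R" if "x \<in> space M" for x
  proof -
    have "(x, f x) \<in> R" if "x \<in> D'" using that fE C(2) by (auto simp: D'_def E1_def)
    moreover have "(x, g x) \<in> R" if "x \<in> F'" using that gE C(2) by (auto simp: F'_def E2_def)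
    moreover have "(x, x) \<in> R" using R \<open>x \<in> space M\<close> by (meson equiv_def refl_onD)
    ultimately show ?thesis by (simp add: \<phi>_def)
  qed
  have N2_sets: "N2 \<in> sets M" using F(4) \<nu>(2) by auto
  have "{x \<in> D. f x \<in> N2} \<in> null_sets M"
  proof -
    have "0 = emeasure \<nu> N2" using F(4) by auto
    also have "\<dots> = emeasure (restrict_space M D) (f -` N2 \<inter> space (restrict_space M D))"
      unfolding \<nu>_def by (rule emeasure_distr[OF D(3) N2_sets])
    also have "f -` N2 \<inter> space (restrict_space M D) = {x \<in> D. f x \<in> N2}"
      using sets.sets_into_space[OF D(1)] by (auto simp: space_restrict_space)
    also have "emeasure (restrict_space M D) \<dots> = emeasure M \<dots>"
      using D(1) by (intro emeasure_restrict_space) auto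
    finally show ?thesis using pre[OF N2_sets] by auto
  qed
  then have "N1 \<union> {x \<in> D. f x \<in> N2} \<in> null_sets M" using D(4) by auto
  then have "AE x in M. \<forall>y. x \<in> A \<and> C `` {x} \<inter> B = {y} \<and> C `` {y} \<inter> A = {x} \<longrightarrow> \<phi> x = y"
  proof (rule AE_I', intro subsetI)
    fix x assume "x \<in> {x \<in> space M. \<not> (\<forall>y. x \<in> A \<and> C `` {x} \<inter> B = {y} \<and> C `` {y} \<inter> A = {x} \<longrightarrow> \<phi> x = y)}"
    then have "\<exists>y. (x \<in> A \<and> C `` {x} \<inter> B = {y} \<and> C `` {y} \<inter> A = {x}) \<and> \<phi> x \<noteq> y"
      by (auto simp only: mem_Collect_eq not_all not_imp)
    then obtain y where xy: "x \<in> A" "C `` {x} \<inter> B = {y}" "C `` {y} \<inter> A = {x}" "\<phi> x \<noteq> y"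
      by (elim exE conjE)
    have xyE: "(x, y) \<in> E1" using xy by (auto simp: E1_def)
    have "y' = y" if "(x, y') \<in> E1" for y' using that xy(2) by (auto simp: E1_def)
    then have "x \<in> {x. \<exists>!y. (x, y) \<in> E1}" using xyE by blast
    moreover have "x' = x" if "(y, x') \<in> E2" for x' using that xy(3) by (auto simp: E2_def)
    then have "y \<in> {x. \<exists>!y. (x, y) \<in> E2}" using xyE unfolding E12 by blast
    moreover have "\<not> (x \<in> D \<and> y \<in> F)"
      using xyE xy(4) f_eq by (auto simp: \<phi>_def D'_def)
    ultimately show "x \<in> N1 \<union> {x \<in> D. f x \<in> N2}" using D(5) F(5) f_eq[OF xyE] by blast
  qed
  then show ?thesis using aut graph by blast
qed

text \<open>Let \<open>(x, y) \<in> C n\<close> with \<open>x \<noteq> y\<close>. As the sections of \<open>C n\<close> are finite, there are disjoint sets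
  \<open>A\<close> and \<open>B\<close> in a fixed countable base with \<open>x \<in> A\<close> and \<open>y \<in> B\<close> in which both are the only partner
  of the other one. So the automorphisms obtained from all \<open>n\<close>, \<open>A\<close>, \<open>B\<close>, and the identity,
  suffice.\<close>
theorem automorphisms_exhaust_equivalence_relation:
  fixes M :: "'a measure" and C :: "nat \<Rightarrow> ('a \<times> 'a) set"
  assumes M: "prob_space M" "standard_borel M" and R: "equiv (space M) R"
    and C: "\<And>n. C n \<in> souslin (sets (M \<Otimes>\<^sub>M M))" "\<And>n. sym (C n)"
      "\<And>n x. x \<in> space M \<Longrightarrow> finite (C n `` {x})" "R = (\<Union>n. C n)"
  obtains \<phi> :: "nat \<Rightarrow> 'a \<Rightarrow> 'a" where "\<And>i. borel_automorphism M (\<phi> i)"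
    "\<And>i x. x \<in> space M \<Longrightarrow> (x, \<phi> i x) \<in> R" "AE x in M. \<forall>y. (x, y) \<in> R \<longrightarrow> (\<exists>i. \<phi> i x = y)"
proof -
  interpret prob_space M by fact
  obtain U where sep: "separating_base M U" using ex_separating_base[OF M(2)] ..
  note U = separating_base_sets[OF sep]
  have id: "borel_automorphism M (\<lambda>x. x)" "\<And>x. x \<in> space M \<Longrightarrow> (x, x) \<in> R"
  proof -
    have "the_inv_into (space M) (\<lambda>x. x) \<in> measurable M M \<longleftrightarrow> (\<lambda>x. x) \<in> measurable M M"
      by (rule measurable_cong) (simp add: the_inv_into_f_eq)
    then show "borel_automorphism M (\<lambda>x. x)"
      by (auto simp: borel_automorphism_def bij_betw_def)
    show "(x, x) \<in> R" if "x \<in> space M" for x using R that by (meson equiv_def refl_onD)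
  qed
  define swaps where "swaps n j k \<phi> \<longleftrightarrow> borel_automorphism M \<phi> \<and> (\<forall>x\<in>space M. (x, \<phi> x) \<in> R) \<and>
     (U j \<inter> U k = {} \<longrightarrow> (AE x in M. \<forall>y. x \<in> U j \<and> C n `` {x} \<inter> U k = {y} \<and> C n `` {y} \<inter> U j = {x} \<longrightarrow> \<phi> x = y))"
    for n j k \<phi>
  have "\<exists>\<phi>. swaps n j k \<phi>" for n j k
  proof (cases "U j \<inter> U k = {}")
    case True
    have "C n \<subseteq> R" using C(4) by auto
    from automorphism_from_unique_partners[OF M R C(1) this C(2) U U True]
    show ?thesis unfolding swaps_def by fast
  next
    case False
    then have "swaps n j k (\<lambda>x. x)" using id by (simp add: swaps_def)
    then show ?thesis by blast
  qed
  then obtain \<psi> where "\<And>n j k. swaps n j k (\<psi> n j k)" by metis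
  then have \<psi>: "\<And>n j k. borel_automorphism M (\<psi> n j k)"
    "\<And>n j k x. x \<in> space M \<Longrightarrow> (x, \<psi> n j k x) \<in> R"
    "\<And>n j k. U j \<inter> U k = {} \<Longrightarrow>
       AE x in M. \<forall>y. x \<in> U j \<and> C n `` {x} \<inter> U k = {y} \<and> C n `` {y} \<inter> U j = {x} \<longrightarrow> \<psi> n j k x = y"
    unfolding swaps_def by simp_all
  define \<phi> where "\<phi> i = (case i of 0 \<Rightarrow> (\<lambda>x. x)
      | Suc i \<Rightarrow> (case prod_decode i of (n, jk) \<Rightarrow> (case prod_decode jk of (j, k) \<Rightarrow> \<psi> n j k)))" for i
  show ?thesis
  proof (rule that)
    show "borel_automorphism M (\<phi> i)" for i
      using \<psi>(1) id by (auto simp: \<phi>_def split: nat.split prod.split)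
    show "(x, \<phi> i x) \<in> R" if "x \<in> space M" for i x
      using \<psi>(2) id that by (auto simp: \<phi>_def split: nat.split prod.split)
    have "AE x in M. \<forall>n j k. U j \<inter> U k = {} \<longrightarrow>
        (\<forall>y. x \<in> U j \<and> C n `` {x} \<inter> U k = {y} \<and> C n `` {y} \<inter> U j = {x} \<longrightarrow> \<psi> n j k x = y)"
      unfolding AE_all_countable using \<psi>(3) by auto
    then show "AE x in M. \<forall>y. (x, y) \<in> R \<longrightarrow> (\<exists>i. \<phi> i x = y)"
    proof eventually_elim
      case (elim x)
      show ?case
      proof (intro allI impI)
        fix y assume xy: "(x, y) \<in> R"
        then have sp: "x \<in> space M" "y \<in> space M" using R by (auto simp: equiv_def refl_on_def)
        show "\<exists>i. \<phi> i x = y"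
        proof (cases "x = y")
          case True
          then show ?thesis by (intro exI[of _ 0]) (simp add: \<phi>_def)
        next
          case False
          obtain n where n: "(x, y) \<in> C n" using xy C(4) by auto
          then have n': "(y, x) \<in> C n" using C(2) by (meson symD)
          obtain j k where jk: "x \<in> U j" "y \<in> U k" "U j \<inter> U k = {}"
              "U j \<inter> (C n `` {y} - {x}) = {}" "U k \<inter> (C n `` {x} - {y}) = {}"
            using separating_baseE[OF sep sp False, of "C n `` {y} - {x}" "C n `` {x} - {y}"] C(3) sp
            by auto
          have "C n `` {x} \<inter> U k = {y}" "C n `` {y} \<inter> U j = {x}" using jk n n' by auto
          then have "\<psi> n j k x = y"
            using elim[THEN spec[of _ n], THEN spec[of _ j], THEN spec[of _ k]] jk(1,3) by simp
          then have "\<phi> (Suc (prod_encode (n, prod_encode (j, k)))) x = y" by (simp add: \<phi>_def)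
          then show ?thesis by blast
        qed
      qed
    qed
  qed
qed

text \<open>Measure-preserving maps pull null sets back to null sets, and countably many of them reach
  the whole class.\<close>
lemma AE_on_classes:
  assumes \<phi>: "\<And>i::nat. \<phi> i \<in> measurable M M" "\<And>i. distr M M (\<phi> i) = M"
      "AE x in M. \<forall>y. (x, y) \<in> R \<longrightarrow> (\<exists>i. \<phi> i x = y)"
    and P: "AE x in M. P x"
  shows "AE x in M. \<forall>y. (x, y) \<in> R \<longrightarrow> P y"
proof -
  have "AE x in M. P (\<phi> i x)" for i
  proof (rule AE_distrD[OF \<phi>(1)])
    show "AE x in distr M M (\<phi> i). P x" using P by (simp only: \<phi>(2))
  qed
  then have "AE x in M. \<forall>i. P (\<phi> i x)" by (simp add: AE_all_countable)
  then show ?thesis using \<phi>(3) by eventually_elim metis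
qed

text \<open>Think of \<open>\<Gamma>\<close> as the graph of the map that, up to a null set, follows the first \<open>\<phi> i\<close> whose
  \<open>G i\<close> contains the point. Its domain is a disjoint union of pieces on which it is one of the
  \<open>\<phi> i\<close>, so the images of the pieces have total measure at most 1. By the Borel-Cantelli lemma
  almost every point lies in finitely many of these images, and each \<open>\<phi> i\<close> is injective.\<close>
lemma finite_to_one_selection:
  fixes \<phi> :: "nat \<Rightarrow> 'a \<Rightarrow> 'a"
  assumes M: "prob_space M"
    and \<phi>: "\<And>i. borel_automorphism M (\<phi> i)" "\<And>i. distr M M (\<phi> i) = M"
    and G: "\<And>i. G i \<in> sets (completion M)" "AE y in M. \<exists>i. y \<in> G i"
  obtains \<Gamma> where "AE y in M. \<exists>i. y \<in> G i \<and> (y, \<phi> i y) \<in> \<Gamma>" "AE z in M. finite {y. (y, z) \<in> \<Gamma>}"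
proof -
  interpret prob_space M by fact
  have "\<forall>i. \<exists>L N. L \<in> sets M \<and> N \<in> null_sets M \<and> L \<subseteq> G i \<and> G i - L \<subseteq> N"
    using sets_completion_inner[OF G(1)] by metis
  then obtain L N where LN: "\<And>n. L n \<in> sets M" "\<And>n. N n \<in> null_sets M" "\<And>n. L n \<subseteq> G n"
      "\<And>n. G n - L n \<subseteq> N n"
    by metis
  \<comment> \<open>Disjoint pieces make the total measure of the images finite.\<close>
  define D where "D = disjointed L"
  have D: "D i \<in> sets M" "D i \<subseteq> G i" for i
  proof -
    have "range L \<subseteq> sets M" using LN(1) by auto
    then show "D i \<in> sets M" using sets.range_disjointed_sets unfolding D_def by blast
    show "D i \<subseteq> G i" using disjointed_subset[of L i] LN(3)[of i] unfolding D_def by blast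
  qed
  have D_Union: "(\<Union>i. D i) = (\<Union>i. L i)" unfolding D_def by (rule UN_disjointed_eq)
  define \<Gamma> where "\<Gamma> = {(y, \<phi> i y) | y i. y \<in> D i}"
  define W where "W i = \<phi> i ` D i" for i
  have bij: "bij_betw (\<phi> i) (space M) (space M)" and inv: "the_inv_into (space M) (\<phi> i) \<in> measurable M M"
    and meas: "\<phi> i \<in> measurable M M" for i
    using \<phi>(1) unfolding borel_automorphism_def by auto
  have Dsp: "D i \<subseteq> space M" for i using D(1) sets.sets_into_space by blast
  have W: "W i \<in> sets M" for i
  proof -
    have "W i = the_inv_into (space M) (\<phi> i) -` D i \<inter> space M"
    proof (intro set_eqI iffI)
      fix z assume "z \<in> W i"
      then obtain x where x: "x \<in> D i" "z = \<phi> i x" unfolding W_def by blast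
      then have "x \<in> space M" using Dsp by blast
      moreover from this have "the_inv_into (space M) (\<phi> i) z = x" "z \<in> space M"
        using bij[of i] x(2) by (auto simp: bij_betw_def the_inv_into_f_f)
      ultimately show "z \<in> the_inv_into (space M) (\<phi> i) -` D i \<inter> space M" using x by simp
    next
      fix z assume z: "z \<in> the_inv_into (space M) (\<phi> i) -` D i \<inter> space M"
      then have "\<phi> i (the_inv_into (space M) (\<phi> i) z) = z"
        using bij[of i] by (intro f_the_inv_into_f) (auto simp: bij_betw_def)
      then show "z \<in> W i" using z unfolding W_def by (metis IntD1 imageI vimageD)
    qed
    then show ?thesis using measurable_sets[OF inv D(1)] by simp
  qed
  have W_measure: "measure M (W i) = measure M (D i)" for i
  proof -
    have "measure M (W i) = measure (distr M M (\<phi> i)) (W i)" by (simp add: \<phi>(2))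
    also have "\<dots> = measure M (\<phi> i -` W i \<inter> space M)" by (rule measure_distr[OF meas W])
    also have "\<phi> i -` W i \<inter> space M = D i"
      using Dsp bij[of i] unfolding W_def bij_betw_def inj_on_def by blast
    finally show ?thesis .
  qed
  have "summable (\<lambda>i. measure M (D i))"
    using finite_measure_UNION[of D] D(1) disjoint_family_disjointed[of L] sums_summable
    unfolding D_def by blast
  then have "AE z in M. eventually (\<lambda>i. z \<in> space M - W i) sequentially"
    by (intro borel_cantelli_AE1 W) (auto simp: W_measure emeasure_finite less_top[symmetric])
  then have "AE z in M. finite {y. (y, z) \<in> \<Gamma>}"
  proof eventually_elim
    case (elim z)
    then obtain n where n: "\<And>i. n \<le> i \<Longrightarrow> z \<notin> W i" unfolding eventually_sequentially by auto
    have "{y. (y, z) \<in> \<Gamma>} \<subseteq> (\<Union>i<n. {y \<in> D i. \<phi> i y = z})"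
    proof clarify
      fix y assume "(y, z) \<in> \<Gamma>"
      then obtain i where i: "y \<in> D i" "\<phi> i y = z" unfolding \<Gamma>_def by blast
      then have "\<not> n \<le> i" using n unfolding W_def by blast
      then show "y \<in> (\<Union>i<n. {y \<in> D i. \<phi> i y = z})" using i by auto
    qed
    moreover have "finite {y \<in> D i. \<phi> i y = z}" for i
    proof -
      have "inj_on (\<phi> i) (D i)" using bij[of i] Dsp by (meson bij_betw_def inj_on_subset)
      then have "finite (\<phi> i -` {z} \<inter> D i)" by (intro finite_vimage_IntI) auto
      moreover have "\<phi> i -` {z} \<inter> D i = {y \<in> D i. \<phi> i y = z}" by auto
      ultimately show ?thesis by simp
    qed
    ultimately show ?case by (meson finite_UN_I finite_lessThan finite_subset)
  qed
  moreover have "AE y in M. \<exists>i. y \<in> G i \<and> (y, \<phi> i y) \<in> \<Gamma>"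
  proof -
    have "AE y in M. \<forall>n. y \<notin> N n"
      unfolding AE_all_countable using LN(2) AE_not_in by blast
    with G(2) show ?thesis
    proof eventually_elim
      case (elim y)
      then have "y \<in> (\<Union>i. L i)" using LN(4) by blast
      then obtain i where "y \<in> D i" using D_Union by blast
      then show ?case using D(2) unfolding \<Gamma>_def by blast
    qed
  qed
  ultimately show ?thesis by (rule that[rotated])
qed

section \<open>Limit points of locally finite subsets of a hyperbolic space\<close>

lemma eventually_prod_sequentially':
  "eventually P (sequentially \<times>\<^sub>F sequentially) \<longleftrightarrow> (\<exists>N. \<forall>i\<ge>N. \<forall>j\<ge>N. P (i, j))"
  unfolding eventually_prod_same eventually_sequentially by auto

lemma extended_product_gt_imp_eventually:
  assumes "extended_gromov_product m z a b > ereal t" "u \<in> representatives a" "v \<in> representatives b"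
  shows "\<exists>N. \<forall>i\<ge>N. \<forall>j\<ge>N. gromov_product m z (u i) (v j) > t"
proof -
  have "extended_gromov_product m z a b \<le>
      Liminf (sequentially \<times>\<^sub>F sequentially) (\<lambda>(i, j). ereal (gromov_product m z (u i) (v j)))"
    unfolding extended_gromov_product_def by (intro INF_lower2[OF assms(2)] INF_lower[OF assms(3)])
  with assms(1) have "ereal t < Liminf (sequentially \<times>\<^sub>F sequentially)
      (\<lambda>(i, j). ereal (gromov_product m z (u i) (v j)))" by (rule less_le_trans)
  then have "eventually (\<lambda>(i, j). ereal t < ereal (gromov_product m z (u i) (v j)))
      (sequentially \<times>\<^sub>F sequentially)"
    by (auto dest!: less_LiminfD simp: case_prod_unfold)
  then show ?thesis by (simp add: eventually_prod_sequentially')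
qed

lemma extended_product_geI:
  assumes "\<And>u v. u \<in> representatives a \<Longrightarrow> v \<in> representatives b \<Longrightarrow>
      \<exists>N. \<forall>i\<ge>N. \<forall>j\<ge>N. gromov_product m z (u i) (v j) \<ge> t"
  shows "extended_gromov_product m z a b \<ge> ereal t"
  unfolding extended_gromov_product_def
proof (intro INF_greatest Liminf_bounded)
  fix u v assume "u \<in> representatives a" "v \<in> representatives b"
  then show "eventually (\<lambda>x. ereal t \<le> (case x of (i, j) \<Rightarrow> ereal (gromov_product m z (u i) (v j))))
      (sequentially \<times>\<^sub>F sequentially)"
    using assms by (simp add: eventually_prod_sequentially')
qed

lemma gromov_boundary_representatives:
  assumes "\<xi> \<in> gromov_boundary m"
  shows "\<xi> \<noteq> {}" "\<xi> \<subseteq> gromov_sequences m"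
  using assms unfolding gromov_boundary_def gromov_sequences_def by (auto elim!: quotientE)

lemma gromov_completion_representatives:
  assumes "a \<in> gromov_completion m"
  shows "representatives a \<noteq> {}" "u \<in> representatives a \<Longrightarrow> u i \<in> mspace m"
proof -
  show "representatives a \<noteq> {}"
    using assms gromov_boundary_representatives(1)[of _ m] by (auto simp: gromov_completion_def)
  show "u i \<in> mspace m" if "u \<in> representatives a"
    using assms that gromov_boundary_representatives(2)[of _ m]
    by (fastforce simp: gromov_completion_def gromov_sequences_def)
qed

lemma Inr_in_gromov_completion: "Inr \<zeta> \<in> gromov_completion m \<longleftrightarrow> \<zeta> \<in> gromov_boundary m"
  by (auto simp: gromov_completion_def)

lemma Inl_in_gromov_completion: "Inl p \<in> gromov_completion m \<longleftrightarrow> p \<in> mspace m"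
  by (auto simp: gromov_completion_def)

text \<open>Between a representative of \<open>a\<close> and one of \<open>c\<close> any single representative of \<open>b\<close> can be
  inserted, so the defining infimum over representatives does not increase the constant.\<close>
lemma extended_product_hyperbolic:
  assumes hyp: "delta_hyperbolic \<delta> m" and z: "z \<in> mspace m"
    and abc: "a \<in> gromov_completion m" "b \<in> gromov_completion m" "c \<in> gromov_completion m"
    and ab: "extended_gromov_product m z a b > ereal t"
    and bc: "extended_gromov_product m z b c > ereal t"
  shows "extended_gromov_product m z a c \<ge> ereal (t - \<delta>)"
proof (rule extended_product_geI)
  fix u w assume u: "u \<in> representatives a" and w: "w \<in> representatives c"
  obtain v where v: "v \<in> representatives b" using gromov_completion_representatives(1)[OF abc(2)] by blast
  obtain N1 where N1: "\<And>i j. i \<ge> N1 \<Longrightarrow> j \<ge> N1 \<Longrightarrow> gromov_product m z (u i) (v j) > t"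
    using extended_product_gt_imp_eventually[OF ab u v] by blast
  obtain N2 where N2: "\<And>i j. i \<ge> N2 \<Longrightarrow> j \<ge> N2 \<Longrightarrow> gromov_product m z (v i) (w j) > t"
    using extended_product_gt_imp_eventually[OF bc v w] by blast
  have "gromov_product m z (u i) (w k) \<ge> t - \<delta>" if "i \<ge> max N1 N2" "k \<ge> max N1 N2" for i k
  proof -
    define j where "j = max N1 N2"
    have "gromov_product m z (u i) (w k) \<ge>
        min (gromov_product m z (u i) (v j)) (gromov_product m z (v j) (w k)) - \<delta>"
      using hyp z gromov_completion_representatives(2) abc u v w
      unfolding delta_hyperbolic_def by blast
    moreover have "gromov_product m z (u i) (v j) > t" "gromov_product m z (v j) (w k) > t"
      using that N1 N2 by (auto simp: j_def)
    ultimately show ?thesis by linarith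
  qed
  then show "\<exists>N. \<forall>i\<ge>N. \<forall>j\<ge>N. gromov_product m z (u i) (w j) \<ge> t - \<delta>" by blast
qed

lemma extended_product_Inl:
  "extended_gromov_product m z (Inl p) (Inl q) = ereal (gromov_product m z p q)"
  by (simp add: extended_gromov_product_def case_prod_unfold Liminf_const prod_filter_eq_bot)

lemma gromov_product_base_change:
  assumes "x \<in> mspace m" "y \<in> mspace m" "z \<in> mspace m" "b' \<in> mspace m"
  shows "gromov_product m z x y \<le> gromov_product m b' x y + mdist m b' z"
proof -
  have "mdist m x z \<le> mdist m x b' + mdist m b' z" "mdist m y z \<le> mdist m y b' + mdist m b' z"
    using assms by (auto intro: mdist_triangle)
  then show ?thesis unfolding gromov_product_def by (simp add: field_simps)
qed

lemma extended_product_base_change: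
  assumes ab: "a \<in> gromov_completion m" "b \<in> gromov_completion m"
    and z: "z \<in> mspace m" "b' \<in> mspace m"
    and t: "extended_gromov_product m z a b > ereal t"
  shows "extended_gromov_product m b' a b \<ge> ereal (t - mdist m b' z)"
proof (rule extended_product_geI)
  fix u v assume uv: "u \<in> representatives a" "v \<in> representatives b"
  obtain N where N: "\<And>i j. i \<ge> N \<Longrightarrow> j \<ge> N \<Longrightarrow> gromov_product m z (u i) (v j) > t"
    using extended_product_gt_imp_eventually[OF t uv] by blast
  have "gromov_product m b' (u i) (v j) \<ge> t - mdist m b' z" if "i \<ge> N" "j \<ge> N" for i j
  proof -
    have "gromov_product m z (u i) (v j) \<le> gromov_product m b' (u i) (v j) + mdist m b' z"
      using gromov_completion_representatives(2) ab uv z by (intro gromov_product_base_change) blast+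
    then show ?thesis using N[OF that] by linarith
  qed
  then show "\<exists>N. \<forall>i\<ge>N. \<forall>j\<ge>N. gromov_product m b' (u i) (v j) \<ge> t - mdist m b' z" by blast
qed

lemma extended_product_le_dist:
  assumes a: "a \<in> gromov_completion m" and p: "p \<in> mspace m" and z: "z \<in> mspace m"
    and t: "extended_gromov_product m z a (Inl p) > ereal t"
  shows "t < mdist m z p"
proof -
  obtain u where u: "u \<in> representatives a" using gromov_completion_representatives(1)[OF a] by blast
  obtain N where "gromov_product m z (u N) p > t"
    using extended_product_gt_imp_eventually[OF t u, of "\<lambda>_. p"] by auto
  moreover have "mdist m (u N) z \<le> mdist m (u N) p + mdist m p z"
    using gromov_completion_representatives(2)[OF a u] p z by (intro mdist_triangle)
  ultimately show ?thesis unfolding gromov_product_def by (simp add: mdist_commute)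
qed

lemma openin_complement_locally_finite:
  assumes S: "S \<subseteq> mspace m"
    and fin: "\<And>p r. p \<in> mspace m \<Longrightarrow> finite (S \<inter> mball_of m p r)"
  shows "openin (mtopology_of m) (mspace m - S)"
proof -
  have "\<exists>r>0. mball_of m p r \<subseteq> mspace m - S" if p: "p \<in> mspace m - S" for p
  proof -
    define F where "F = S \<inter> mball_of m p 1"
    have "finite F" using fin p by (simp add: F_def)
    have pos: "0 < mdist m p s" if "s \<in> F" for s
    proof -
      have "mdist m p s \<noteq> 0" using that p S by (auto simp: F_def)
      then show ?thesis using mdist_nonneg[of m p s] by linarith
    qed
    have "\<exists>r>0. \<forall>s\<in>F. r \<le> mdist m p s"
    proof (cases "F = {}")
      case False
      then have "0 < Min (mdist m p ` F)"
        using \<open>finite F\<close> pos by (subst Min_gr_iff) auto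
      then show ?thesis using \<open>finite F\<close> by (intro exI[of _ "Min (mdist m p ` F)"]) auto
    qed (auto intro: exI[of _ 1])
    then obtain r where r: "0 < r" "\<And>s. s \<in> F \<Longrightarrow> r \<le> mdist m p s" by blast
    have "q \<notin> S" if "q \<in> mball_of m p (min r 1)" for q
    proof
      assume "q \<in> S"
      then have "q \<in> F" using that by (simp add: F_def)
      then show False using r(2)[of q] that by simp
    qed
    then have "mball_of m p (min r 1) \<subseteq> mspace m - S" by auto
    then show ?thesis using r(1) by (intro exI[of _ "min r 1"]) auto
  qed
  then show ?thesis
    unfolding mtopology_of_def Metric_space.openin_mtopology[OF Metric_space_mspace_mdist] mball_of_def
    by auto
qed

text \<open>The topology of the completion is given by its open sets, so for the converse of
  \<open>products_unbounded_imp_limit_point\<close> an open set is needed that contains \<open>\<xi>\<close> and misses \<open>S\<close>: the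
  complement of \<open>S\<close> and of all boundary points whose products with \<open>S\<close> are unbounded. It is open
  in the space because \<open>S\<close> is locally finite, and it is a neighbourhood of its boundary points
  because by hyperbolicity bounded products stay bounded at nearby boundary points.\<close>
lemma limit_point_imp_products_unbounded:
  assumes hyp: "delta_hyperbolic \<delta> m" and z0: "z0 \<in> mspace m" and S: "S \<subseteq> mspace m"
    and fin: "\<And>p r. p \<in> mspace m \<Longrightarrow> finite (S \<inter> mball_of m p r)"
    and \<xi>: "\<xi> \<in> gromov_boundary m"
    and lim: "Inr \<xi> \<in> gromov_topology m closure_of (Inl ` S)"
  shows "\<exists>s\<in>S. extended_gromov_product m z0 (Inr \<xi>) (Inl s) > ereal t"
proof (rule ccontr)
  assume no: "\<not> ?thesis"
  define L where "L = {\<zeta> \<in> gromov_boundary m.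
      \<forall>t::real. \<exists>s\<in>S. extended_gromov_product m z0 (Inr \<zeta>) (Inl s) > ereal t}"
  define U where "U = gromov_completion m - Inl ` S - Inr ` L"
  have bd: "Inr \<zeta> \<in> gromov_completion m" if "\<zeta> \<in> gromov_boundary m" for \<zeta>
    using that by (simp add: Inr_in_gromov_completion)
  have pt: "Inl s \<in> gromov_completion m" if "s \<in> S" for s
    using that S by (auto simp: gromov_completion_def)
  have "gromov_open m U"
    unfolding gromov_open_def
  proof (intro conjI allI impI ballI)
    show "U \<subseteq> gromov_completion m" by (auto simp: U_def)
    have "Inl -` U = mspace m - S" by (auto simp: U_def gromov_completion_def)
    moreover have "openin (mtopology_of m) (mspace m - S)"
      by (rule openin_complement_locally_finite[OF S fin])
    ultimately show "openin (mtopology_of m) (Inl -` U)" by simp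
    fix \<zeta> z assume \<zeta>U: "Inr \<zeta> \<in> U" and z: "z \<in> mspace m"
    then have \<zeta>: "\<zeta> \<in> gromov_boundary m" "\<zeta> \<notin> L" by (auto simp: U_def gromov_completion_def)
    then obtain t0 :: real where t0: "\<And>s. s \<in> S \<Longrightarrow> \<not> extended_gromov_product m z0 (Inr \<zeta>) (Inl s) > ereal t0"
      unfolding L_def by blast
    define D where "D = mdist m z0 z"
    \<comment> \<open>Large enough that a product above \<open>T - \<delta>\<close> at \<open>z\<close> exceeds \<open>t0\<close> at \<open>z0\<close>.\<close>
    define T where "T = t0 + \<bar>\<delta>\<bar> + D + 1"
    have far: "\<not> extended_gromov_product m z (Inr \<zeta>) (Inl s) \<ge> ereal (T - \<delta>)" if "s \<in> S" for s
    proof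
      assume "extended_gromov_product m z (Inr \<zeta>) (Inl s) \<ge> ereal (T - \<delta>)"
      moreover have "ereal (t0 + D + 1/2) < ereal (T - \<delta>)" by (simp add: T_def)
      ultimately have "extended_gromov_product m z (Inr \<zeta>) (Inl s) > ereal (t0 + D + 1/2)"
        by (rule less_le_trans[rotated])
      from extended_product_base_change[OF bd[OF \<zeta>(1)] pt[OF that] z z0 this]
      have "extended_gromov_product m z0 (Inr \<zeta>) (Inl s) \<ge> ereal (t0 + 1/2)" by (simp add: D_def)
      moreover have "ereal t0 < ereal (t0 + 1/2)" by simp
      ultimately have "extended_gromov_product m z0 (Inr \<zeta>) (Inl s) > ereal t0"
        by (rule less_le_trans[rotated])
      then show False using t0[OF that] by simp
    qed
    have "a \<in> U" if a: "a \<in> gromov_completion m" "extended_gromov_product m z (Inr \<zeta>) a > ereal (T + \<bar>\<delta>\<bar>)" for a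
    proof (rule ccontr)
      assume "a \<notin> U"
      then consider s where "s \<in> S" "a = Inl s" | \<zeta>' where "\<zeta>' \<in> L" "a = Inr \<zeta>'"
        using a(1) by (auto simp: U_def)
      then show False
      proof cases
        case 1
        have "ereal (T - \<delta>) \<le> ereal (T + \<bar>\<delta>\<bar>)" by simp
        then show False using far[OF 1(1)] a(2) 1(2) by (meson less_imp_le order_trans)
      next
        case 2
        then have \<zeta>': "\<zeta>' \<in> gromov_boundary m" by (simp add: L_def)
        obtain s where s: "s \<in> S" "extended_gromov_product m z0 (Inr \<zeta>') (Inl s) > ereal (T + D + 1)"
          using 2(1) unfolding L_def by blast
        have "extended_gromov_product m z (Inr \<zeta>') (Inl s) \<ge> ereal (T + D + 1 - mdist m z z0)"
          by (rule extended_product_base_change[OF bd[OF \<zeta>'] pt[OF s(1)] z0 z s(2)])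
        moreover have "ereal T < ereal (T + D + 1 - mdist m z z0)" by (simp add: D_def mdist_commute)
        ultimately have "extended_gromov_product m z (Inr \<zeta>') (Inl s) > ereal T"
          by (rule less_le_trans[rotated])
        moreover have "extended_gromov_product m z (Inr \<zeta>) (Inr \<zeta>') > ereal T"
          using a(2) 2(2) by (auto elim: le_less_trans[rotated])
        ultimately have "extended_gromov_product m z (Inr \<zeta>) (Inl s) \<ge> ereal (T - \<delta>)"
          using extended_product_hyperbolic[OF hyp z bd[OF \<zeta>(1)] bd[OF \<zeta>'] pt[OF s(1)]] by blast
        then show False using far[OF s(1)] by blast
      qed
    qed
    then show "\<exists>t::real. {a \<in> gromov_completion m. extended_gromov_product m z (Inr \<zeta>) a > ereal t} \<subseteq> U"
      by blast
  qed
  moreover have "Inr \<xi> \<in> U"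
    using no \<xi> bd[OF \<xi>] by (auto simp: U_def L_def)
  ultimately have "\<exists>y. y \<in> Inl ` S \<and> y \<in> U"
    using lim unfolding in_closure_of openin_gromov_topology by blast
  then show False by (auto simp: U_def)
qed

lemma products_unbounded_imp_limit_point:
  assumes z0: "z0 \<in> mspace m" and S: "S \<subseteq> mspace m" and \<xi>: "\<xi> \<in> gromov_boundary m"
    and ex: "\<And>t::real. \<exists>s\<in>S. extended_gromov_product m z0 (Inr \<xi>) (Inl s) > ereal t"
  shows "Inr \<xi> \<in> gromov_topology m closure_of (Inl ` S)"
  unfolding in_closure_of
proof (intro conjI allI impI)
  show "Inr \<xi> \<in> topspace (gromov_topology m)" using \<xi> by (simp add: Inr_in_gromov_completion)
  fix U assume U: "Inr \<xi> \<in> U \<and> openin (gromov_topology m) U"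
  then obtain t :: real where t: "{a \<in> gromov_completion m. extended_gromov_product m z0 (Inr \<xi>) a > ereal t} \<subseteq> U"
    using z0 unfolding openin_gromov_topology gromov_open_def by blast
  obtain s where "s \<in> S" "extended_gromov_product m z0 (Inr \<xi>) (Inl s) > ereal t" using ex by blast
  then have "Inl s \<in> U" using t S by (auto simp: gromov_completion_def)
  then show "\<exists>y. y \<in> Inl ` S \<and> y \<in> U" using \<open>s \<in> S\<close> by blast
qed

text \<open>The geometric heart. For infinitely many \<open>y\<close> the point \<open>a y\<close> is seen from a base point in
  the direction \<open>\<xi>\<close>. If all \<open>b z\<close> stay away from that direction, then up to a constant the distance
  from \<open>a y\<close> to \<open>b z\<close> is the sum of their distances to the base point. The base point is itself one
  of the points \<open>b w\<close>, so the \<open>b z\<close> nearest to \<open>a y\<close> has bounded distance from it. Only finitely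
  many \<open>z\<close> qualify, and infinitely many \<open>y\<close> would have to share one of them.\<close>
lemma limit_points_through_nearest_points:
  fixes a b :: "'i \<Rightarrow> 'b"
  assumes hyp: "gromov_hyperbolic m"
    and ab: "\<And>y. y \<in> I \<Longrightarrow> a y \<in> mspace m" "\<And>y. y \<in> I \<Longrightarrow> b y \<in> mspace m"
    and fin_a: "\<And>p r. p \<in> mspace m \<Longrightarrow> finite {y \<in> I. a y \<in> mball_of m p r}"
    and fin_b: "\<And>p r. p \<in> mspace m \<Longrightarrow> finite {y \<in> I. b y \<in> mball_of m p r}"
    and near: "\<And>y. y \<in> I \<Longrightarrow> \<exists>z\<in>I. (y, z) \<in> \<Gamma> \<and> (\<forall>w\<in>I. mdist m (a y) (b z) \<le> mdist m (a y) (b w))"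
    and fin_\<Gamma>: "\<And>z. z \<in> I \<Longrightarrow> finite {y. (y, z) \<in> \<Gamma>}"
    and \<xi>: "\<xi> \<in> gromov_boundary m" "Inr \<xi> \<in> gromov_topology m closure_of (Inl ` a ` I)"
  shows "Inr \<xi> \<in> gromov_topology m closure_of (Inl ` b ` I)"
proof -
  obtain \<delta> where \<delta>: "delta_hyperbolic \<delta> m" using hyp unfolding gromov_hyperbolic_def by blast
  have "I \<noteq> {}"
    using \<xi>(2) by (auto simp: closure_of_empty)
  then obtain w where w: "w \<in> I" by blast
  define z0 where "z0 = b w"
  have z0: "z0 \<in> mspace m" using w ab by (simp add: z0_def)
  define P where "P s = extended_gromov_product m z0 (Inr \<xi>) (Inl s)" for s
  have bd: "Inr \<xi> \<in> gromov_completion m" using \<xi> by (simp add: Inr_in_gromov_completion)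
  have pa: "Inl (a y) \<in> gromov_completion m" if "y \<in> I" for y
    using that ab by (simp add: Inl_in_gromov_completion)
  have pb: "Inl (b y) \<in> gromov_completion m" if "y \<in> I" for y
    using that ab by (simp add: Inl_in_gromov_completion)
  have "finite (a ` I \<inter> mball_of m p r)" if "p \<in> mspace m" for p r
  proof -
    have "a ` I \<inter> mball_of m p r \<subseteq> a ` {y \<in> I. a y \<in> mball_of m p r}" by auto
    then show ?thesis using fin_a[OF that] finite_subset by blast
  qed
  then have unb: "\<exists>y\<in>I. P (a y) > ereal t" for t
    using limit_point_imp_products_unbounded[OF \<delta> z0 _ _ \<xi>, of t] ab by (auto simp: P_def)
  show ?thesis
  proof (rule products_unbounded_imp_limit_point[OF z0 _ \<xi>(1)])
    show "b ` I \<subseteq> mspace m" using ab by auto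
    fix t :: real
    show "\<exists>s\<in>b ` I. extended_gromov_product m z0 (Inr \<xi>) (Inl s) > ereal t"
    proof (rule ccontr)
      assume "\<not> ?thesis"
      then have small: "\<And>y. y \<in> I \<Longrightarrow> \<not> P (b y) > ereal t" by (auto simp: P_def)
      define T where "T = t + \<bar>\<delta>\<bar> + 1"
      define Y where "Y = {y \<in> I. P (a y) > ereal T}"
      \<comment> \<open>The product of \<open>\<xi>\<close> with a point is at most the distance of that point from the base point,
        so finitely many points have bounded products.\<close>
      have "infinite Y"
      proof
        assume "finite Y"
        define t' where "t' = Max (insert T ((\<lambda>y. mdist m z0 (a y)) ` Y))"
        obtain y where y: "y \<in> I" "P (a y) > ereal t'" using unb by blast
        have "T \<le> t'" using \<open>finite Y\<close> by (simp add: t'_def)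
        then have "ereal T \<le> ereal t'" by simp
        then have "ereal T < P (a y)" using y(2) by (rule le_less_trans)
        then have "y \<in> Y" using y(1) unfolding Y_def by simp
        then have "mdist m z0 (a y) \<le> t'" using \<open>finite Y\<close> by (simp add: t'_def)
        moreover have "t' < mdist m z0 (a y)"
          using extended_product_le_dist[OF bd ab(1)[OF y(1)] z0] y(2) unfolding P_def by blast
        ultimately show False by simp
      qed
      define Q where "Q = {z \<in> I. b z \<in> mball_of m z0 (2 * T + 1)}"
      have "finite Q" unfolding Q_def by (rule fin_b[OF z0])
      have "\<exists>z\<in>Q. (y, z) \<in> \<Gamma>" if "y \<in> Y" for y
      proof -
        have y: "y \<in> I" "P (a y) > ereal T" using that by (auto simp: Y_def)
        obtain z where z: "z \<in> I" "(y, z) \<in> \<Gamma>" "mdist m (a y) (b z) \<le> mdist m (a y) z0"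
          using near[OF y(1)] w unfolding z0_def by blast
        have "gromov_product m z0 (a y) (b z) \<le> T"
        proof (rule ccontr)
          assume "\<not> ?thesis"
          then have "extended_gromov_product m z0 (Inl (a y)) (Inl (b z)) > ereal T"
            by (simp add: extended_product_Inl)
          from extended_product_hyperbolic[OF \<delta> z0 bd pa[OF y(1)] pb[OF z(1)] y(2)[unfolded P_def] this]
          have "P (b z) \<ge> ereal (T - \<delta>)" by (simp add: P_def)
          moreover have "ereal t < ereal (T - \<delta>)" by (simp add: T_def)
          ultimately have "P (b z) > ereal t" by (rule less_le_trans[rotated])
          then show False using small[OF z(1)] by blast
        qed
        then have "mdist m (a y) z0 + mdist m (b z) z0 - mdist m (a y) (b z) \<le> 2 * T"
          by (simp add: gromov_product_def)
        then have "mdist m z0 (b z) < 2 * T + 1" using z(3) by (simp add: mdist_commute)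
        then have "z \<in> Q" using z(1) ab z0 by (simp add: Q_def in_mball_of)
        then show ?thesis using z(2) by blast
      qed
      then have "Y \<subseteq> (\<Union>z\<in>Q. {y. (y, z) \<in> \<Gamma>})" by blast
      moreover have "finite (\<Union>z\<in>Q. {y. (y, z) \<in> \<Gamma>})"
        using \<open>finite Q\<close> fin_\<Gamma> by (auto simp: Q_def)
      ultimately show False using \<open>infinite Y\<close> finite_subset by blast
    qed
  qed
qed

section \<open>Limit sets of metrically proper sections\<close>

lemma fiber_distance_measurable:
  assumes M: "standard_borel M" and H: "metric_bundle M H \<pi> d"
  shows "{(p, q). (p, q) \<in> fiber_product H \<pi> \<and> d p q < r} \<in> sets (H \<Otimes>\<^sub>M H)"
proof -
  have \<pi>: "\<pi> \<in> measurable H M"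
    and d: "(\<lambda>(p, q). d p q) \<in> borel_measurable (restrict_space (H \<Otimes>\<^sub>M H) (fiber_product H \<pi>))"
    using H by (auto simp: metric_bundle_def borel_bundle_def)
  let ?N = "{(x, y). x \<in> space M \<and> y \<in> space M \<and> x \<noteq> y}"
  have pr: "(\<lambda>w. (\<pi> (fst w), \<pi> (snd w))) \<in> measurable (H \<Otimes>\<^sub>M H) (M \<Otimes>\<^sub>M M)"
    using \<pi> by measurable
  have "fiber_product H \<pi> = space (H \<Otimes>\<^sub>M H) - ((\<lambda>w. (\<pi> (fst w), \<pi> (snd w))) -` ?N \<inter> space (H \<Otimes>\<^sub>M H))"
    using measurable_space[OF \<pi>] by (auto simp: fiber_product_def space_pair_measure)
  also have "\<dots> \<in> sets (H \<Otimes>\<^sub>M H)"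
    using measurable_sets[OF pr standard_borel_diagonal_complement[OF M]] by auto
  finally have fp: "fiber_product H \<pi> \<in> sets (H \<Otimes>\<^sub>M H)" .
  let ?F = "restrict_space (H \<Otimes>\<^sub>M H) (fiber_product H \<pi>)"
  have "(\<lambda>(p, q). d p q) -` {..<r} \<inter> space ?F \<in> sets ?F"
    using d by (rule measurable_sets) simp
  moreover have "(\<lambda>(p, q). d p q) -` {..<r} \<inter> space ?F = {(p, q). (p, q) \<in> fiber_product H \<pi> \<and> d p q < r}"
    by (auto simp: space_restrict_space fiber_product_def space_pair_measure)
  ultimately show ?thesis using fp by (simp add: sets_restrict_space_iff)
qed

text \<open>Borel data describe the action only through its graph, and so the point
  \<open>\<alpha>(x, y) t(y)\<close> has to be quantified: the set is the projection of a Borel set of triples along the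
  total space.\<close>
lemma close_pairs_souslin:
  assumes M: "standard_borel M" and H: "metric_bundle M H \<pi> d"
    and \<alpha>: "isometric_action R H \<pi> d \<alpha>" and R: "equiv (space M) R"
    and s: "borel_section M H \<pi> s" and t: "borel_section M H \<pi> t"
  shows "{(x, y). (x, y) \<in> R \<and> d (s x) (\<alpha> x y (t y)) < r} \<in> souslin (sets (M \<Otimes>\<^sub>M M))"
proof -
  define MMH where "MMH = (M \<Otimes>\<^sub>M M) \<Otimes>\<^sub>M H"
  define G where "G = {(p, q). p \<in> space H \<and> q \<in> space H \<and> (\<pi> p, \<pi> q) \<in> R \<and> \<alpha> (\<pi> p) (\<pi> q) q = p}"
  define N where "N = {(p, q). (p, q) \<in> fiber_product H \<pi> \<and> d p q < r}"
  have G: "G \<in> sets (H \<Otimes>\<^sub>M H)" using \<alpha> by (simp add: isometric_action_def G_def)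
  have N: "N \<in> sets (H \<Otimes>\<^sub>M H)" unfolding N_def by (rule fiber_distance_measurable[OF M H])
  have sH: "standard_borel H" using H by (simp add: metric_bundle_def borel_bundle_def)
  have meas: "s \<in> measurable M H" "t \<in> measurable M H" using s t by (auto simp: borel_section_def)
  have s_fib: "s x \<in> space H" "\<pi> (s x) = x" if "x \<in> space M" for x
    using s that by (auto simp: borel_section_def fiber_def)
  have t_fib: "t x \<in> space H" "\<pi> (t x) = x" if "x \<in> space M" for x
    using t that by (auto simp: borel_section_def fiber_def)
  have R_space: "x \<in> space M" "y \<in> space M" if "(x, y) \<in> R" for x y
    using R that by (auto simp: equiv_def refl_on_def)
  have u: "(\<lambda>w. (snd w, t (snd (fst w)))) \<in> measurable MMH (H \<Otimes>\<^sub>M H)"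
    and v: "(\<lambda>w. (s (fst (fst w)), snd w)) \<in> measurable MMH (H \<Otimes>\<^sub>M H)"
    unfolding MMH_def using meas by measurable
  define E where "E = ((\<lambda>w. (snd w, t (snd (fst w)))) -` G \<inter> space MMH) \<inter>
      ((\<lambda>w. (s (fst (fst w)), snd w)) -` N \<inter> space MMH)"
  have "E \<in> sets MMH"
    unfolding E_def by (intro sets.Int measurable_sets[OF u G] measurable_sets[OF v N])
  then have "fst ` E \<in> souslin (sets (M \<Otimes>\<^sub>M M))"
    unfolding MMH_def by (intro souslin_projection[OF sH] subsetD[OF souslin_superset])
  moreover have "fst ` E = {(x, y). (x, y) \<in> R \<and> d (s x) (\<alpha> x y (t y)) < r}"
  proof (intro set_eqI iffI)
    fix xy assume "xy \<in> fst ` E"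
    then obtain x y p where xy: "xy = (x, y)" "((x, y), p) \<in> E" by force
    then have *: "x \<in> space M" "y \<in> space M" "(p, t y) \<in> G" "(s x, p) \<in> N"
      by (auto simp: E_def MMH_def space_pair_measure)
    then have "\<pi> p = x" using s_fib by (simp add: N_def fiber_product_def)
    then have "(x, y) \<in> R" "\<alpha> x y (t y) = p" using * t_fib by (auto simp: G_def)
    then show "xy \<in> {(x, y). (x, y) \<in> R \<and> d (s x) (\<alpha> x y (t y)) < r}"
      using xy *(4) by (simp add: N_def)
  next
    fix xy assume "xy \<in> {(x, y). (x, y) \<in> R \<and> d (s x) (\<alpha> x y (t y)) < r}"
    then obtain x y where xy: "xy = (x, y)" "(x, y) \<in> R" "d (s x) (\<alpha> x y (t y)) < r" by auto
    note sp = R_space[OF xy(2)]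
    have "bij_betw (\<alpha> x y) (fiber H \<pi> y) (fiber H \<pi> x)"
      using \<alpha> xy(2) by (auto simp: isometric_action_def)
    moreover have "t y \<in> fiber H \<pi> y" using t_fib[OF sp(2)] by (simp add: fiber_def)
    ultimately have "\<alpha> x y (t y) \<in> fiber H \<pi> x" by (rule bij_betw_apply)
    then have "\<alpha> x y (t y) \<in> space H" "\<pi> (\<alpha> x y (t y)) = x" by (auto simp: fiber_def)
    then have "((x, y), \<alpha> x y (t y)) \<in> E"
      using xy sp s_fib[OF sp(1)] t_fib[OF sp(2)]
      by (auto simp: E_def MMH_def space_pair_measure G_def N_def fiber_product_def)
    then show "xy \<in> fst ` E" unfolding xy(1) by force
  qed
  ultimately show ?thesis by simp
qed

lemma isometric_action_fiber:
  assumes "isometric_action R H \<pi> d \<alpha>" "(x, y) \<in> R" "p \<in> fiber H \<pi> y"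
  shows "\<alpha> x y p \<in> fiber H \<pi> x"
  using assms by (auto simp: isometric_action_def dest!: bspec[of R _ "(x, y)"] bij_betw_apply)

lemma isometric_action_dist:
  assumes "isometric_action R H \<pi> d \<alpha>" "(x, y) \<in> R" "p \<in> fiber H \<pi> y" "q \<in> fiber H \<pi> y"
  shows "d (\<alpha> x y p) (\<alpha> x y q) = d p q"
  using assms by (auto simp: isometric_action_def)

lemma isometric_action_comp:
  assumes "isometric_action R H \<pi> d \<alpha>" "(x, y) \<in> R" "(y, z) \<in> R" "p \<in> fiber H \<pi> z"
  shows "\<alpha> x y (\<alpha> y z p) = \<alpha> x z p"
  using assms by (auto simp: isometric_action_def)

text \<open>The cocycle identity makes \<open>\<alpha> x x\<close> idempotent, and an injective idempotent map is the
  identity.\<close>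
lemma isometric_action_id:
  assumes \<alpha>: "isometric_action R H \<pi> d \<alpha>" and "(x, x) \<in> R" "p \<in> fiber H \<pi> x"
  shows "\<alpha> x x p = p"
proof -
  have "inj_on (\<alpha> x x) (fiber H \<pi> x)"
    using assms by (auto simp: isometric_action_def bij_betw_def)
  moreover have "\<alpha> x x (\<alpha> x x p) = \<alpha> x x p" using assms by (rule_tac isometric_action_comp)
  ultimately show ?thesis using assms isometric_action_fiber by (metis inj_onD)
qed

text \<open>Properness of \<open>\<sigma>\<close> serves twice: the distances within its orbit cut the relation into
  pieces with finite sections, which yields the automorphisms \<open>\<phi> i\<close>, and it makes limit points come
  from infinitely many points of the class. A point is good if \<open>\<Gamma>\<close> leads from it to a nearest point
  of the other orbit and only finitely many points lead to it; almost every class consists of good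
  points, and on such a class the geometric argument applies.\<close>
lemma limit_set_subset:
  assumes main: "main_assumption M R H \<pi> d \<alpha>"
    and \<sigma>: "borel_section M H \<pi> \<sigma>" "metrically_proper M R H \<pi> d \<alpha> \<sigma>"
    and \<eta>: "borel_section M H \<pi> \<eta>" "metrically_proper M R H \<pi> d \<alpha> \<eta>"
  shows "AE x in M. limit_set R H \<pi> d \<alpha> \<sigma> x \<subseteq> limit_set R H \<pi> d \<alpha> \<eta> x"
proof -
  have M: "prob_space M" "standard_borel M" and R: "equiv (space M) R"
    and inv: "invariant_under M R" and H: "metric_bundle M H \<pi> d" and \<alpha>: "isometric_action R H \<pi> d \<alpha>"
    and hyp: "\<And>x. x \<in> space M \<Longrightarrow> gromov_hyperbolic (fiber_metric H \<pi> d x)"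
    using main by (auto simp: main_assumption_def discrete_borel_equiv_def hyperbolic_bundle_def)
  interpret prob_space M by (rule M)
  have R_space: "x \<in> space M" "y \<in> space M" if "(x, y) \<in> R" for x y
    using R that by (auto simp: equiv_def refl_on_def)
  have R_refl: "(x, x) \<in> R" if "x \<in> space M" for x using R that by (meson equiv_def refl_onD)
  have R_sym: "(y, x) \<in> R" if "(x, y) \<in> R" for x y using R that by (meson equiv_def symD)
  have R_trans: "(x, z) \<in> R" if "(x, y) \<in> R" "(y, z) \<in> R" for x y z
    using R that by (meson equiv_def transD)
  have fib: "\<sigma> x \<in> fiber H \<pi> x" "\<eta> x \<in> fiber H \<pi> x" if "x \<in> space M" for x
    using \<sigma>(1) \<eta>(1) that by (auto simp: borel_section_def)
  have d_sym: "d p q = d q p"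
    if "p \<in> fiber H \<pi> x" "q \<in> fiber H \<pi> x" "x \<in> space M" for p q x
  proof -
    interpret Metric_space "fiber H \<pi> x" "dist_on (fiber H \<pi> x) d"
      using H that(3) by (simp add: metric_bundle_def)
    show "d p q = d q p"
      using that commute[of p q] by (simp add: dist_on_def)
  qed
  have \<alpha>_fib: "\<alpha> x y (\<sigma> y) \<in> fiber H \<pi> x" "\<alpha> x y (\<eta> y) \<in> fiber H \<pi> x" if "(x, y) \<in> R" for x y
    using isometric_action_fiber[OF \<alpha> that] fib R_space[OF that] by auto
  have proper: "finite {y. (x, y) \<in> R \<and> d p (\<alpha> x y (s y)) < r}"
    if s: "borel_section M H \<pi> s" "metrically_proper M R H \<pi> d \<alpha> s"
      and x: "x \<in> space M" and p: "p \<in> fiber H \<pi> x" for s x p r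
  proof -
    have "{y. (x, y) \<in> R \<and> d p (\<alpha> x y (s y)) < r}
        \<subseteq> {y \<in> R `` {x}. \<alpha> x y (s y) \<in> mball_of (fiber_metric H \<pi> d x) p r}"
    proof clarify
      fix y assume y: "(x, y) \<in> R" "d p (\<alpha> x y (s y)) < r"
      have "\<alpha> x y (s y) \<in> fiber H \<pi> x"
        using isometric_action_fiber[OF \<alpha> y(1)] s(1) R_space[OF y(1)] by (auto simp: borel_section_def)
      then show "y \<in> R `` {x} \<and> \<alpha> x y (s y) \<in> mball_of (fiber_metric H \<pi> d x) p r"
        using y p by (simp add: metric_bundle_fiber_metric[OF H x] dist_on_def)
    qed
    moreover have "finite {y \<in> R `` {x}. \<alpha> x y (s y) \<in> mball_of (fiber_metric H \<pi> d x) p r}"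
      using s(2) x p by (simp add: metrically_proper_def)
    ultimately show ?thesis by (rule finite_subset)
  qed
  define C where "C n = {(x, y). (x, y) \<in> R \<and> d (\<sigma> x) (\<alpha> x y (\<sigma> y)) < real n}" for n
  obtain \<phi> :: "nat \<Rightarrow> 'a \<Rightarrow> 'a" where \<phi>: "\<And>i. borel_automorphism M (\<phi> i)"
    "\<And>i x. x \<in> space M \<Longrightarrow> (x, \<phi> i x) \<in> R" "AE x in M. \<forall>y. (x, y) \<in> R \<longrightarrow> (\<exists>i. \<phi> i x = y)"
  proof (rule automorphisms_exhaust_equivalence_relation[OF M R])
    show "C n \<in> souslin (sets (M \<Otimes>\<^sub>M M))" for n
      unfolding C_def by (rule close_pairs_souslin[OF M(2) H \<alpha> R \<sigma>(1) \<sigma>(1)])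
    show "sym (C n)" for n
    proof (rule symI)
      fix x y assume "(x, y) \<in> C n"
      then have xy: "(x, y) \<in> R" "d (\<sigma> x) (\<alpha> x y (\<sigma> y)) < real n" by (auto simp: C_def)
      have yx: "(y, x) \<in> R" and sp: "x \<in> space M" "y \<in> space M"
        using R_sym[OF xy(1)] R_space[OF xy(1)] by auto
      have "d (\<alpha> y x (\<sigma> x)) (\<alpha> y x (\<alpha> x y (\<sigma> y))) = d (\<sigma> x) (\<alpha> x y (\<sigma> y))"
        by (rule isometric_action_dist[OF \<alpha> yx]) (use fib sp \<alpha>_fib[OF xy(1)] in auto)
      moreover have "\<alpha> y x (\<alpha> x y (\<sigma> y)) = \<sigma> y"
        using isometric_action_comp[OF \<alpha> yx xy(1)] isometric_action_id[OF \<alpha>] R_refl fib sp by simp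
      moreover have "d (\<alpha> y x (\<sigma> x)) (\<sigma> y) = d (\<sigma> y) (\<alpha> y x (\<sigma> x))"
        by (rule d_sym[OF \<alpha>_fib(1)[OF yx] fib(1)[OF sp(2)] sp(2)])
      ultimately show "(y, x) \<in> C n" using xy yx by (simp add: C_def)
    qed
    show "finite (C n `` {x})" if "x \<in> space M" for n x
    proof -
      have "C n `` {x} = {y. (x, y) \<in> R \<and> d (\<sigma> x) (\<alpha> x y (\<sigma> y)) < real n}" by (auto simp: C_def)
      then show ?thesis using proper[OF \<sigma> that fib(1)[OF that]] by simp
    qed
    show "R = (\<Union>n. C n)"
      using reals_Archimedean2 by (auto simp: C_def)
  qed (rule that)
  have \<phi>_meas: "\<phi> i \<in> measurable M M" for i using \<phi>(1) by (simp add: borel_automorphism_def)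
  have \<phi>_inv: "distr M M (\<phi> i) = M" for i using inv \<phi>(1,2) by (simp add: invariant_under_def)
  define \<rho> where "\<rho> y z = d (\<sigma> y) (\<alpha> y z (\<eta> z))" for y z
  \<comment> \<open>The points \<open>y\<close> for which \<open>\<phi> i y\<close> is a nearest point of the other orbit.\<close>
  define G where "G i = {y \<in> space M. \<forall>j. \<rho> y (\<phi> i y) \<le> \<rho> y (\<phi> j y)}" for i
  have \<rho>_meas: "(\<lambda>y. \<rho> y (\<phi> i y)) \<in> borel_measurable (completion M)" for i
    unfolding borel_measurable_iff_less
  proof
    fix r
    have "(\<lambda>y. (y, \<phi> i y)) \<in> measurable M (M \<Otimes>\<^sub>M M)" using \<phi>_meas by measurable
    then have "(\<lambda>y. (y, \<phi> i y)) -` {(x, y). (x, y) \<in> R \<and> d (\<sigma> x) (\<alpha> x y (\<eta> y)) < r} \<inter> space M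
        \<in> souslin (sets M)"
      by (rule souslin_vimage[OF close_pairs_souslin[OF M(2) H \<alpha> R \<sigma>(1) \<eta>(1)]])
    moreover have "(\<lambda>y. (y, \<phi> i y)) -` {(x, y). (x, y) \<in> R \<and> d (\<sigma> x) (\<alpha> x y (\<eta> y)) < r} \<inter> space M
        = {y \<in> space (completion M). \<rho> y (\<phi> i y) < r}"
      using \<phi>(2) by (auto simp: \<rho>_def)
    ultimately show "{y \<in> space (completion M). \<rho> y (\<phi> i y) < r} \<in> sets (completion M)"
      using souslin_sets_completion by simp
  qed
  have G_sets: "G i \<in> sets (completion M)" for i
  proof -
    have "{y \<in> space (completion M). \<forall>j. \<rho> y (\<phi> i y) \<le> \<rho> y (\<phi> j y)} \<in> sets (completion M)"
      using \<rho>_meas by (intro sets.sets_Collect_countable_All borel_measurable_le)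
    then show ?thesis by (simp add: G_def)
  qed
  have G_ex: "\<exists>i. y \<in> G i" if y: "y \<in> space M" for y
  proof -
    \<comment> \<open>By properness only finitely many points compete with \<open>\<phi> 0 y\<close>.\<close>
    define K where "K = {z. (y, z) \<in> R \<and> \<rho> y z < \<rho> y (\<phi> 0 y) + 1} \<inter> range (\<lambda>j. \<phi> j y)"
    have "finite K" unfolding K_def \<rho>_def using proper[OF \<eta> y fib(1)[OF y]] by blast
    moreover have "\<phi> 0 y \<in> K" using \<phi>(2)[OF y] by (auto simp: K_def)
    ultimately obtain z where z: "is_arg_min (\<rho> y) (\<lambda>z. z \<in> K) z"
      using ex_is_arg_min_if_finite[of K "\<rho> y"] by blast
    then obtain i where i: "z = \<phi> i y" "\<rho> y z < \<rho> y (\<phi> 0 y) + 1" by (auto simp: is_arg_min_def K_def)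
    have "\<rho> y (\<phi> i y) \<le> \<rho> y (\<phi> j y)" for j
    proof (cases "\<phi> j y \<in> K")
      case True
      then show ?thesis using z i unfolding is_arg_min_linorder by blast
    next
      case False
      then have "\<rho> y (\<phi> 0 y) + 1 \<le> \<rho> y (\<phi> j y)" using \<phi>(2)[OF y] by (auto simp: K_def)
      then show ?thesis using i by simp
    qed
    then show ?thesis using y by (auto simp: G_def)
  qed
  obtain \<Gamma> where \<Gamma>: "AE y in M. \<exists>i. y \<in> G i \<and> (y, \<phi> i y) \<in> \<Gamma>" "AE z in M. finite {y. (y, z) \<in> \<Gamma>}"
  proof (rule finite_to_one_selection[OF M(1) \<phi>(1) \<phi>_inv G_sets])
    show "AE y in M. \<exists>i. y \<in> G i" using G_ex by (rule AE_I2)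
  qed (rule that)
  define good where "good y \<longleftrightarrow> (\<exists>i. y \<in> G i \<and> (y, \<phi> i y) \<in> \<Gamma>) \<and> finite {y'. (y', y) \<in> \<Gamma>} \<and>
      (\<forall>z. (y, z) \<in> R \<longrightarrow> (\<exists>i. \<phi> i y = z))" for y
  have "AE y in M. good y" using \<Gamma> \<phi>(3) unfolding good_def by eventually_elim blast
  then have "AE x in M. \<forall>y. (x, y) \<in> R \<longrightarrow> good y"
    by (rule AE_on_classes[OF \<phi>_meas \<phi>_inv \<phi>(3)])
  then show ?thesis
  proof (rule AE_mp, intro AE_I2 impI)
    fix x assume x: "x \<in> space M" and good: "\<forall>y. (x, y) \<in> R \<longrightarrow> good y"
    let ?m = "fiber_metric H \<pi> d x" and ?I = "R `` {x}"
    note m = metric_bundle_fiber_metric[OF H x]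
    show "limit_set R H \<pi> d \<alpha> \<sigma> x \<subseteq> limit_set R H \<pi> d \<alpha> \<eta> x"
      unfolding limit_set_def orbit_closure_def orbit_def
    proof
      fix a assume "a \<in> gromov_topology ?m closure_of Inl ` (\<lambda>y. \<alpha> x y (\<sigma> y)) ` ?I \<inter> Inr ` gromov_boundary ?m"
      then obtain \<xi> where a: "a = Inr \<xi>"
        and \<xi>: "Inr \<xi> \<in> gromov_topology ?m closure_of Inl ` (\<lambda>y. \<alpha> x y (\<sigma> y)) ` ?I" "\<xi> \<in> gromov_boundary ?m"
        by blast
      have "Inr \<xi> \<in> gromov_topology ?m closure_of Inl ` (\<lambda>y. \<alpha> x y (\<eta> y)) ` ?I"
      proof (rule limit_points_through_nearest_points[OF hyp[OF x] _ _ _ _ _ _ \<xi>(2,1), where \<Gamma>=\<Gamma>])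
        show "\<alpha> x y (\<sigma> y) \<in> mspace ?m" if "y \<in> ?I" for y using that \<alpha>_fib m by simp
        show "\<alpha> x y (\<eta> y) \<in> mspace ?m" if "y \<in> ?I" for y using that \<alpha>_fib m by simp
        show "finite {y \<in> ?I. \<alpha> x y (\<sigma> y) \<in> mball_of ?m p r}" if "p \<in> mspace ?m" for p r
        proof -
          have "p \<in> fiber H \<pi> x" using that m(1) by simp
          then show ?thesis using \<sigma>(2) x unfolding metrically_proper_def by blast
        qed
        show "finite {y \<in> ?I. \<alpha> x y (\<eta> y) \<in> mball_of ?m p r}" if "p \<in> mspace ?m" for p r
        proof -
          have "p \<in> fiber H \<pi> x" using that m(1) by simp
          then show ?thesis using \<eta>(2) x unfolding metrically_proper_def by blast
        qed
        show "finite {y. (y, z) \<in> \<Gamma>}" if "z \<in> ?I" for z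
          using that good by (simp add: good_def)
        fix y assume "y \<in> ?I"
        then have xy: "(x, y) \<in> R" by simp
        then obtain i where i: "y \<in> G i" "(y, \<phi> i y) \<in> \<Gamma>" using good by (auto simp: good_def)
        have y: "y \<in> space M" using R_space[OF xy] by simp
        have dist: "mdist ?m (\<alpha> x y (\<sigma> y)) (\<alpha> x z (\<eta> z)) = \<rho> y z" if yz: "(y, z) \<in> R" for z
        proof -
          have "\<alpha> x z (\<eta> z) = \<alpha> x y (\<alpha> y z (\<eta> z))"
            using isometric_action_comp[OF \<alpha> xy yz] fib R_space[OF yz] by simp
          moreover have "mdist ?m (\<alpha> x y (\<sigma> y)) (\<alpha> x z (\<eta> z)) = d (\<alpha> x y (\<sigma> y)) (\<alpha> x z (\<eta> z))"
            using \<alpha>_fib(1)[OF xy] \<alpha>_fib(2)[OF R_trans[OF xy yz]] m by (simp add: dist_on_def)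
          moreover have "d (\<alpha> x y (\<sigma> y)) (\<alpha> x y (\<alpha> y z (\<eta> z))) = \<rho> y z"
            unfolding \<rho>_def by (rule isometric_action_dist[OF \<alpha> xy fib(1)[OF y] \<alpha>_fib(2)[OF yz]])
          ultimately show ?thesis by simp
        qed
        show "\<exists>z\<in>?I. (y, z) \<in> \<Gamma> \<and> (\<forall>w\<in>?I. mdist ?m (\<alpha> x y (\<sigma> y)) (\<alpha> x z (\<eta> z)) \<le> mdist ?m (\<alpha> x y (\<sigma> y)) (\<alpha> x w (\<eta> w)))"
        proof (intro bexI conjI ballI)
          show "(y, \<phi> i y) \<in> \<Gamma>" by (rule i)
          show "\<phi> i y \<in> ?I" using R_trans[OF xy \<phi>(2)[OF y]] by simp
          fix w assume "w \<in> ?I"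
          then have yw: "(y, w) \<in> R" using R_trans[OF R_sym[OF xy]] by simp
          then obtain j where "\<phi> j y = w" using good xy by (auto simp: good_def)
          then have "\<rho> y (\<phi> i y) \<le> \<rho> y w" using i(1) by (auto simp: G_def)
          then show "mdist ?m (\<alpha> x y (\<sigma> y)) (\<alpha> x (\<phi> i y) (\<eta> (\<phi> i y))) \<le> mdist ?m (\<alpha> x y (\<sigma> y)) (\<alpha> x w (\<eta> w))"
            using dist[OF yw] dist[OF \<phi>(2)[OF y]] by simp
        qed
      qed
      then show "a \<in> gromov_topology ?m closure_of Inl ` (\<lambda>y. \<alpha> x y (\<eta> y)) ` ?I \<inter> Inr ` gromov_boundary ?m"
        using \<xi>(2) unfolding a by blast
    qed
  qed
qed

theorem theorem1p1:
  fixes M :: "'a measure" and R :: "('a \<times> 'a) set"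
    and H :: "'b measure" and \<pi> :: "'b \<Rightarrow> 'a" and d :: "'b \<Rightarrow> 'b \<Rightarrow> real"
    and \<alpha> :: "'a \<Rightarrow> 'a \<Rightarrow> 'b \<Rightarrow> 'b" and \<sigma> \<eta> :: "'a \<Rightarrow> 'b"
  assumes "main_assumption M R H \<pi> d \<alpha>"
    and "borel_section M H \<pi> \<sigma>" and "metrically_proper M R H \<pi> d \<alpha> \<sigma>"
    and "borel_section M H \<pi> \<eta>" and "metrically_proper M R H \<pi> d \<alpha> \<eta>"
    and "AE x in M. compactin (gromov_topology (fiber_metric H \<pi> d x))
                      (orbit_closure R H \<pi> d \<alpha> \<sigma> x)"
    and "AE x in M. compactin (gromov_topology (fiber_metric H \<pi> d x))
                      (orbit_closure R H \<pi> d \<alpha> \<eta> x)"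
  shows "AE x in M. limit_set R H \<pi> d \<alpha> \<sigma> x = limit_set R H \<pi> d \<alpha> \<eta> x"
  using limit_set_subset[OF assms(1-5)] limit_set_subset[OF assms(1,4,5,2,3)]
  by eventually_elim (rule subset_antisym)

end
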